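(* Let $b:\mathbb R^d\to\mathbb R^d$ and $\sigma:\mathbb R^d\to\mathbb R^{d\times m}$. (1) Suppose there exist positive constants $L_0,\dots,L_4$ and $q$ such that for all $x,y\in\mathbb R^d$, $$2\langle x-y,b(x)-b(y)\rangle+\|\sigma(x)-\sigma(y)\|^2\le L_0|x-y|^2,\quad 2\langle x,b(x)\rangle+\|\sigma(x)\|^2\le L_1-L_2|x|^{q+2},\quad |b(x)|\le L_3+L_4|x|^{q+1}.$$ Let $b_\tau:\mathbb R^d\to\mathbb R^d$, $\sigma_\tau:\mathbb R^d\to\mathbb R^{d\times m}$ $(\tau\in(0,1])$ be tamed coefficients as in the context, and assume that $b_\tau$ and $\sigma_\tau$ are continuously differentiable and that for every $x\in\mathbb R^d$ the matrix $\sigma_\tau(x)\sigma_\tau(x)^\top$ is positive definite on $\mathbb R^d$. Then there exists $\widetilde\tau_{\max}\in(0,1]$ such that for any $\tau\in(0,\widetilde\tau_{\max}]$ the scheme $$Z_n=Z_{n-1}+b_\tau(Z_{n-1})\tau+\sigma_\tau(Z_{n-1})(W(t_n)-W(t_{n-1})),\quad n\in\mathbb N_+,$$ is geometrically ergodic with respect to a unique invariant probability measure $\pi_\tau$ on $\mathcal B(\mathbb R^d)$, i.e. there exist $r_0\in(0,1)$ and $\kappa\in(0,\infty)$, depending on $\tau$, such that for any measurable $\phi:\mathbb R^d\to\mathbb R$ with $|\phi|\le1+|\cdot|^2$, $$|\mathbb E\phi(Z_n^x)-\pi_\tau(\phi)|\le\kappa r_0^n(1+|x|^2),\qquad \forall\,x\in\mathbb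 R^d,\ n\in\mathbb N,$$ where $Z^x$ is the chain started at $Z_0=x$. (2) Suppose there exist positive constants $L_3,L_4,L_1',L_2',L_3',L_4'$ and $q$ such that for all $x\in\mathbb R^d$, $$|b(x)|\le L_3+L_4|x|^{q+1},\qquad 2\langle x,b(x)\rangle\le L_1'-L_2'|x|^{q+2},\qquad \|\sigma(x)\|^2\le L_3'+L_4'|x|^2 .$$ Let $b_\tau(x):=b(x)/(1+\tau|x|^{2q})^{1/2}$, and assume that $b_\tau$ and $\sigma$ are continuously differentiable and that $\sigma(x)\sigma(x)^\top$ is positive definite on $\mathbb R^d$ for every $x\in\mathbb R^d$. Then there exists $\widetilde\tau_{\max}'\in(0,1]$ such that for any $\tau\in(0,\widetilde\tau_{\max}']$ the scheme $$\widetilde Z_n=\widetilde Z_{n-1}+b_\tau(\widetilde Z_{n-1})\tau+\sigma(\widetilde Z_{n-1})(W(t_n)-W(t_{n-1})),\quad n\in\mathbb N_+,$$ is geometrically ergodic, in the same sense as in (1): it has a unique invariant probability measure $\widetilde\pi_\tau$ and there exist $r_0\in(0,1)$ and $\kappa\in(0,\infty)$, depending on $\tau$, such that $|\mathbb E\phi(\widetilde Z_n^x)-\widetilde\pi_\tau(\phi)|\le\kappa r_0^n(1+|x|^2)$ for all $x\in\mathbb R^d$, $n\in\mathbb N$ and all measurable $\phi$ with $|\phi|\le1+|\cdot|^2$.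
   Context: $W$ is an $\mathbb R^m$-valued Wiener process on a complete filtered probability space, $\tau\in(0,1]$ is the time step and $t_n:=n\tau$. $|\cdot|$ and $\langle\cdot,\cdot\rangle$ are the Euclidean norm and inner product, $\|\cdot\|$ is the Hilbert--Schmidt norm on $\mathbb R^{d\times m}$, and $\pi(\phi):=\int\phi\,d\pi$. The schemes discretize the SDE $dX(t)=b(X(t))\,dt+\sigma(X(t))\,dW(t)$. Standing assumptions on the tamed coefficients $b_\tau,\sigma_\tau$ in part (1): for each $\tau\in(0,1]$ both have at most linear growth (bounded by $c_\tau(1+|x|)$); they converge to $b$ and $\sigma$ as $\tau\to0$; and there exist positive constants $T_1,T_2$, independent of $\tau$, such that for all $x\in\mathbb R^d$ and $\tau\in(0,1]$, $$2\langle x,b_\tau(x)\rangle+\|\sigma_\tau(x)\|^2+\tau|b_\tau(x)|^2\le T_1-T_2|x|^2 .$$ *)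

theory Defs
  imports "HOL-Probability.Probability"
begin

locale complete_filtered_prob_space = prob_space M + complete_measure M
  for M :: "'w measure" +
  fixes F :: "real \<Rightarrow> 'w measure"
    \<comment> \<open>only the \<open>\<sigma>\<close>-algebras \<open>F t\<close> with \<open>t \<ge> 0\<close> are relevant\<close>
  assumes subalgebra_F: "0 \<le> t \<Longrightarrow> subalgebra M (F t)"
    and F_mono: "0 \<le> s \<Longrightarrow> s \<le> t \<Longrightarrow> subalgebra (F t) (F s)"
    and null_sets_F: "null_sets M \<subseteq> sets (F 0)"

text \<open>
  The increment over \<open>[s, t]\<close> is distributed as \<open>N(0, (t - s) I)\<close>. Its density is the product of
  one-dimensional normal densities, whose second parameter is the standard deviation.
\<close>

locale wiener_process = complete_filtered_prob_space M F
  for M :: "'w measure" and F :: "real \<Rightarrow> 'w measure" +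
  fixes W :: "real \<Rightarrow> 'w \<Rightarrow> real ^ 'm"
  assumes adapted: "0 \<le> t \<Longrightarrow> W t \<in> borel_measurable (F t)"
    and start: "AE \<omega> in M. W 0 \<omega> = 0"
    and continuous_paths: "AE \<omega> in M. continuous_on {0..} (\<lambda>t. W t \<omega>)"
    and indep_increments: "0 \<le> s \<Longrightarrow> s < t \<Longrightarrow>
      indep_set (sets (F s)) {(\<lambda>\<omega>. W t \<omega> - W s \<omega>) -` A \<inter> space M |A. A \<in> sets borel}"
    and gaussian_increments: "0 \<le> s \<Longrightarrow> s < t \<Longrightarrow>
      distributed M lborel (\<lambda>\<omega>. W t \<omega> - W s \<omega>)
        (\<lambda>x. ennreal (\<Prod>i\<in>UNIV. normal_density 0 (sqrt (t - s)) (x $ i)))"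

text \<open>
  Matrices in \<open>\<real>\<^bsup>d\<times>m\<^esup>\<close> are elements of \<^typ>\<open>real ^ 'm ^ 'd\<close>, on which the library norm is the
  Hilbert--Schmidt norm:
\<close>

lemma norm_matrix_power2:
  fixes A :: "real ^ 'm ^ 'd"
  shows "(norm A)\<^sup>2 = (\<Sum>i\<in>UNIV. \<Sum>j\<in>UNIV. (A $ i $ j)\<^sup>2)"
  by (simp add: norm_vec_def L2_set_def sum_nonneg)

definition positive_definite :: "real ^ 'd ^ 'd \<Rightarrow> bool" where
  "positive_definite A \<longleftrightarrow> transpose A = A \<and> (\<forall>v. v \<noteq> 0 \<longrightarrow> 0 < v \<bullet> (A *v v))"

definition continuously_differentiable ::
    "('a::real_normed_vector \<Rightarrow> 'b::real_normed_vector) \<Rightarrow> bool" where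
  "continuously_differentiable f \<longleftrightarrow>
    (\<exists>f' :: 'a \<Rightarrow> 'a \<Rightarrow>\<^sub>L 'b.
      (\<forall>x. (f has_derivative blinfun_apply (f' x)) (at x)) \<and> continuous_on UNIV f')"

definition tamed_coefficients ::
    "(real ^ 'd \<Rightarrow> real ^ 'd) \<Rightarrow> (real ^ 'd \<Rightarrow> real ^ 'm ^ 'd) \<Rightarrow>
     (real \<Rightarrow> real ^ 'd \<Rightarrow> real ^ 'd) \<Rightarrow> (real \<Rightarrow> real ^ 'd \<Rightarrow> real ^ 'm ^ 'd) \<Rightarrow> bool" where
  "tamed_coefficients b \<sigma> b\<tau> \<sigma>\<tau> \<longleftrightarrow>
    (\<forall>\<tau>\<in>{0<..1}. \<exists>c. \<forall>x. norm (b\<tau> \<tau> x) \<le> c * (1 + norm x) \<and> norm (\<sigma>\<tau> \<tau> x) \<le> c * (1 + norm x)) \<and>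
    (\<forall>x. ((\<lambda>\<tau>. b\<tau> \<tau> x) \<longlongrightarrow> b x) (at_right 0)) \<and>
    (\<forall>x. ((\<lambda>\<tau>. \<sigma>\<tau> \<tau> x) \<longlongrightarrow> \<sigma> x) (at_right 0)) \<and>
    (\<exists>T1>0. \<exists>T2>0. \<forall>\<tau>\<in>{0<..1}. \<forall>x.
      2 * (x \<bullet> b\<tau> \<tau> x) + (norm (\<sigma>\<tau> \<tau> x))\<^sup>2 + \<tau> * (norm (b\<tau> \<tau> x))\<^sup>2 \<le> T1 - T2 * (norm x)\<^sup>2)"

primrec em_scheme ::
    "(real ^ 'd \<Rightarrow> real ^ 'd) \<Rightarrow> (real ^ 'd \<Rightarrow> real ^ 'm ^ 'd) \<Rightarrow> (real \<Rightarrow> 'w \<Rightarrow> real ^ 'm) \<Rightarrow> real \<Rightarrow>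
     real ^ 'd \<Rightarrow> nat \<Rightarrow> 'w \<Rightarrow> real ^ 'd" where
  "em_scheme b \<sigma> W \<tau> x 0 \<omega> = x"
| "em_scheme b \<sigma> W \<tau> x (Suc n) \<omega> =
    em_scheme b \<sigma> W \<tau> x n \<omega> + \<tau> *\<^sub>R b (em_scheme b \<sigma> W \<tau> x n \<omega>)
      + \<sigma> (em_scheme b \<sigma> W \<tau> x n \<omega>) *v (W (real (Suc n) * \<tau>) \<omega> - W (real n * \<tau>) \<omega>)"

text \<open>
  In the following two definitions \<open>Z x n\<close> is the state at time \<open>n\<close> of a time-homogeneous Markov
  chain started at \<open>x\<close>, so its one-step transition kernel is the law of \<open>Z x 1\<close>.
\<close>

definition invariant_prob ::
    "'w measure \<Rightarrow> ('a::topological_space \<Rightarrow> nat \<Rightarrow> 'w \<Rightarrow> 'a) \<Rightarrow> 'a measure \<Rightarrow> bool" where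
  "invariant_prob M Z \<pi> \<longleftrightarrow> prob_space \<pi> \<and> sets \<pi> = sets borel \<and>
    (\<forall>A\<in>sets borel. emeasure \<pi> A = (\<integral>\<^sup>+x. emeasure (distr M borel (Z x 1)) A \<partial>\<pi>))"

text \<open>
  The integrability clauses say that the two integrals in the estimate exist: the Bochner integral
  of a non-integrable function is \<open>0\<close> by convention.
\<close>

definition geometrically_ergodic ::
    "'w measure \<Rightarrow> ('a::real_normed_vector \<Rightarrow> nat \<Rightarrow> 'w \<Rightarrow> 'a) \<Rightarrow> bool" where
  "geometrically_ergodic M Z \<longleftrightarrow>
    (\<exists>\<pi>. invariant_prob M Z \<pi> \<and> (\<forall>\<pi>'. invariant_prob M Z \<pi>' \<longrightarrow> \<pi>' = \<pi>) \<and>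
      (\<exists>r0\<in>{0<..<1}. \<exists>\<kappa>>0. \<forall>\<phi>::'a \<Rightarrow> real.
        \<phi> \<in> borel_measurable borel \<longrightarrow> (\<forall>x. \<bar>\<phi> x\<bar> \<le> 1 + (norm x)\<^sup>2) \<longrightarrow>
        integrable \<pi> \<phi> \<and>
        (\<forall>x n. integrable M (\<lambda>\<omega>. \<phi> (Z x n \<omega>)) \<and>
          \<bar>(\<integral>\<omega>. \<phi> (Z x n \<omega>) \<partial>M) - (\<integral>y. \<phi> y \<partial>\<pi>)\<bar> \<le> \<kappa> * r0 ^ n * (1 + (norm x)\<^sup>2))))"

end

theory Submission
  imports Defs
begin

text \<open>
  Fix the step size \<open>\<tau>\<close>. The scheme is a time-homogeneous Markov chain on \<open>\<real>\<^sup>d\<close> whose one-step kernel at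
  \<open>x\<close> is the law of \<open>x + \<tau> b(x) + \<sigma>(x) \<xi>\<close> with \<open>\<xi>\<close> Gaussian of covariance \<open>\<tau> I\<close>. Harris's theorem gives
  geometric ergodicity of such a chain from two properties of the single kernel: a Lyapunov function
  that contracts on average up to a constant, and a nonzero measure below all kernels started in a
  large sublevel set of it.

  The Lyapunov function is \<open>V(x) = |x|\<^sup>2\<close>. Since \<open>\<xi>\<close> is centred with covariance \<open>\<tau> I\<close>, the kernel at \<open>x\<close>
  has second moment \<open>|x + \<tau> b(x)|\<^sup>2 + \<tau> \<parallel>\<sigma>(x)\<parallel>\<^sup>2\<close> (\<open>gaussian_second_moment\<close>), which is
  \<open>|x|\<^sup>2 + \<tau> (2\<langle>x, b\<rangle> + \<parallel>\<sigma>\<parallel>\<^sup>2 + \<tau> |b|\<^sup>2)\<close>. So the drift condition is exactly the dissipativity estimate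
  \<open>2\<langle>x, b\<rangle> + \<parallel>\<sigma>\<parallel>\<^sup>2 + \<tau> |b|\<^sup>2 \<le> T\<^sub>1 - T\<^sub>2 |x|\<^sup>2\<close>. In part (1) it belongs to the assumptions on tamed
  coefficients. In part (2) it holds for small \<open>\<tau>\<close>: for large \<open>|x|\<close> the tamed drift satisfies
  \<open>2\<langle>x, b\<^sub>\<tau>\<rangle> \<le> - c |x|\<^sup>2 / \<surd>\<tau>\<close>, and the factor \<open>1 / \<surd>\<tau>\<close> makes this beat the \<open>\<tau>\<close>-independent quadratic
  growth of \<open>\<parallel>\<sigma>\<parallel>\<^sup>2\<close> and \<open>\<tau> |b\<^sub>\<tau>|\<^sup>2\<close> (\<open>tamed_drift_dissipative\<close>).

  The minorization (\<open>gaussian_kernel_minorization\<close>) comes from non-degeneracy of the noise: since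
  \<open>\<sigma> \<sigma>\<^sup>T\<close> is positive definite, \<open>\<sigma>(x)\<close> has a right inverse, bounded uniformly on compact sets, and every
  displacement of the image of \<open>\<xi>\<close> can be compensated by a bounded displacement of \<open>\<xi>\<close> itself, at the
  cost of a bounded factor in the Gaussian density.

  Harris's theorem is proved with the argument of Hairer and Mattingly. The transition operator is a
  strict contraction for the oscillation of functions weighted by \<open>1 + \<beta> V\<close> with a small \<open>\<beta>\<close>
  (\<open>contraction\<close>). Hence the iterates of any function dominated by \<open>1 + V\<close> converge geometrically to a
  constant. That constant, as a function of the integrand, is integration against a probability
  measure, the invariant one. Finally, independence of the Wiener increments identifies the
  expectations along the scheme with the iterates of the transition operator.
\<close>

section \<open>Harris's theorem\<close>

lemma geometric_increments_converge:
  fixes a :: "nat \<Rightarrow> real"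
  assumes r: "0 \<le> r" "r < 1"
    and inc: "\<And>n. \<bar>a (Suc n) - a n\<bar> \<le> B * r ^ n"
  obtains l where "a \<longlonglongrightarrow> l" "\<And>n. \<bar>a n - l\<bar> \<le> B / (1 - r) * r ^ n"
proof -
  have geom: "summable (\<lambda>n. B * r ^ n)"
    using r by (intro summable_mult summable_geometric) auto
  then have "summable (\<lambda>n. a (Suc n) - a n)"
    by (rule summable_comparison_test'[of _ 0]) (use inc in auto)
  then have "convergent (\<lambda>n. \<Sum>i<n. a (Suc i) - a i)"
    by (simp add: summable_iff_convergent)
  then have "convergent (\<lambda>n. a n - a 0)"
    by (simp add: sum_lessThan_telescope)
  then obtain l where l: "a \<longlonglongrightarrow> l"
    by (auto simp: convergent_diff_const_right_iff convergent_def)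
  have tail: "\<bar>a n - a (n + k)\<bar> \<le> B / (1 - r) * r ^ n * (1 - r ^ k)" for n k
  proof (induction k)
    case (Suc k)
    have "\<bar>a n - a (n + Suc k)\<bar> \<le> \<bar>a n - a (n + k)\<bar> + \<bar>a (Suc (n + k)) - a (n + k)\<bar>"
      by simp
    also have "\<dots> \<le> B / (1 - r) * r ^ n * (1 - r ^ k) + B * r ^ (n + k)"
      using Suc inc[of "n + k"] by linarith
    also have "\<dots> = B / (1 - r) * r ^ n * (1 - r ^ Suc k)"
      using r by (simp add: field_simps power_add)
    finally show ?case .
  qed simp
  have "0 \<le> B"
    using inc[of 0] by simp
  have "\<bar>a n - l\<bar> \<le> B / (1 - r) * r ^ n" for n
  proof (rule LIMSEQ_le_const2)
    show "(\<lambda>k. \<bar>a n - a (k + n)\<bar>) \<longlonglongrightarrow> \<bar>a n - l\<bar>"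
      using LIMSEQ_ignore_initial_segment[OF l, of n] by (intro tendsto_intros)
    have "\<bar>a n - a (k + n)\<bar> \<le> B / (1 - r) * r ^ n" for k
    proof -
      have "B / (1 - r) * r ^ n * (1 - r ^ k) \<le> B / (1 - r) * r ^ n * 1"
        using r \<open>0 \<le> B\<close> by (intro mult_left_mono) auto
      with tail[of n k] show ?thesis by (simp add: add.commute)
    qed
    then show "\<exists>N. \<forall>k\<ge>N. \<bar>a n - a (k + n)\<bar> \<le> B / (1 - r) * r ^ n" by blast
  qed
  with l show ?thesis by (rule that)
qed

text \<open>
  Domination of measures on sets passes to integrals of nonnegative functions. This is how the
  minorization is exploited without forming the signed measure \<open>\<mu> - \<nu>\<close>.
\<close>

lemma integral_mono_setwise:
  fixes f :: "'a \<Rightarrow> real"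
  assumes sets: "sets \<nu> = sets \<mu>" and le: "\<And>A. A \<in> sets \<mu> \<Longrightarrow> emeasure \<nu> A \<le> emeasure \<mu> A"
    and f: "integrable \<mu> f"
  shows "integrable \<nu> f" and "(\<And>x. x \<in> space \<mu> \<Longrightarrow> 0 \<le> f x) \<Longrightarrow> (\<integral>x. f x \<partial>\<nu>) \<le> (\<integral>x. f x \<partial>\<mu>)"
proof -
  have "\<nu> \<le> \<mu>"
    using sets le by (simp add: le_measure)
  note mono = nn_integral_mono_measure[OF sets this]
  have sp: "space \<nu> = space \<mu>" 
    using sets by (rule sets_eq_imp_space_eq)
  have m: "f \<in> borel_measurable \<nu>"
    using borel_measurable_integrable[OF f] by (simp add: measurable_cong_sets[OF sets refl])
  show int: "integrable \<nu> f"
    using f m mono[of "\<lambda>x. ennreal (norm (f x))"] unfolding integrable_iff_bounded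
    by (auto intro: le_less_trans)
  assume pos: "\<And>x. x \<in> space \<mu> \<Longrightarrow> 0 \<le> f x"
  then have "ennreal (\<integral>x. f x \<partial>\<nu>) \<le> ennreal (\<integral>x. f x \<partial>\<mu>)"
    using mono[of "\<lambda>x. ennreal (f x)"] int f
    by (subst (1 2) nn_integral_eq_integral[symmetric]) (auto simp: sp)
  moreover have "0 \<le> (\<integral>x. f x \<partial>\<mu>)"
    using pos by (intro integral_nonneg_AE) auto
  ultimately show "(\<integral>x. f x \<partial>\<nu>) \<le> (\<integral>x. f x \<partial>\<mu>)"
    by simp
qed

text \<open>
  The drift condition pulls the chain towards small values of \<open>V\<close>, and below the level \<open>R\<close> all kernels
  share the common part \<open>\<nu>\<close>. The level has to exceed \<open>2 C / (1 - \<gamma>)\<close>: then, for a pair of starting points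
  with \<open>V x + V y \<ge> R\<close>, the drift beats its own constant, as \<open>\<gamma> (V x + V y) + 2 C < V x + V y\<close>.
\<close>

locale harris_chain =
  fixes S :: "'a measure" and K :: "'a \<Rightarrow> 'a measure" and V :: "'a \<Rightarrow> real"
    and \<gamma> C R :: real and \<nu> :: "'a measure"
  assumes kernel: "K \<in> S \<rightarrow>\<^sub>M prob_algebra S"
    and V_measurable [measurable]: "V \<in> borel_measurable S"
    and V_nonneg: "\<And>x. x \<in> space S \<Longrightarrow> 0 \<le> V x"
    and V_integrable: "\<And>x. x \<in> space S \<Longrightarrow> integrable (K x) V"
    and drift: "\<And>x. x \<in> space S \<Longrightarrow> (\<integral>y. V y \<partial>K x) \<le> \<gamma> * V x + C"
    and rate: "0 \<le> \<gamma>" "\<gamma> < 1"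
    and C_pos: "0 < C"
    and radius: "2 * C / (1 - \<gamma>) < R"
    and sets_minorant: "sets \<nu> = sets S"
    and finite_minorant: "finite_measure \<nu>"
    and minorant_pos: "0 < measure \<nu> (space \<nu>)"
    and minorization: "\<And>x A. x \<in> space S \<Longrightarrow> V x \<le> R \<Longrightarrow> A \<in> sets S \<Longrightarrow> emeasure \<nu> A \<le> emeasure (K x) A"
begin

definition transition :: "('a \<Rightarrow> real) \<Rightarrow> 'a \<Rightarrow> real" where
  "transition \<phi> x = (\<integral>y. \<phi> y \<partial>K x)"

definition dominated :: "real \<Rightarrow> ('a \<Rightarrow> real) \<Rightarrow> bool" where
  "dominated c \<phi> \<longleftrightarrow> \<phi> \<in> borel_measurable S \<and> (\<forall>x\<in>space S. \<bar>\<phi> x\<bar> \<le> c * (1 + V x))"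

definition mass :: real where "mass = measure \<nu> (space \<nu>)"

text \<open>
  The slope of the weight \<open>1 + \<beta> V\<close>. Two points below level \<open>R\<close> gain \<open>2 mass\<close> from the minorization, but
  their drift constants add \<open>2 \<beta> C\<close>; this choice of \<open>\<beta>\<close> lets the constants consume exactly half of the
  gain.
\<close>

definition \<beta> :: real where "\<beta> = mass / (2 * C)"

definition weight :: "'a \<Rightarrow> real" where "weight x = 1 + \<beta> * V x"

text \<open>
  The first entry is the factor obtained below level \<open>R\<close>, the second one the factor obtained above it,
  where \<open>\<gamma> + 2 C / R < 1\<close> is the drift rate after the constant has been absorbed.
\<close>

definition contraction_rate :: real where
  "contraction_rate = max (1 - mass / 2) ((2 + R * \<beta> * (\<gamma> + 2 * C / R)) / (2 + R * \<beta>))"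

lemma prob_K: "x \<in> space S \<Longrightarrow> prob_space (K x)"
  and sets_K: "x \<in> space S \<Longrightarrow> sets (K x) = sets S"
  and space_K: "x \<in> space S \<Longrightarrow> space (K x) = space S"
  using measurable_space[OF kernel] by (auto simp: space_prob_algebra dest: sets_eq_imp_space_eq)

lemma measurable_K: "x \<in> space S \<Longrightarrow> \<phi> \<in> borel_measurable S \<Longrightarrow> \<phi> \<in> borel_measurable (K x)"
  by (simp add: measurable_cong_sets[OF sets_K refl])

lemma space_not_empty: "space S \<noteq> {}"
  using minorant_pos sets_eq_imp_space_eq[OF sets_minorant] by auto

lemma R_pos: "0 < R"
proof -
  have "0 < 2 * C / (1 - \<gamma>)" using C_pos rate by simp
  then show ?thesis using radius by linarith
qed

lemma mass_pos: "0 < mass" and \<beta>_pos: "0 < \<beta>"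
  using minorant_pos C_pos by (auto simp: mass_def \<beta>_def)

lemma relaxed_rate: "\<gamma> + 2 * C / R < 1"
proof -
  have "2 * C < R * (1 - \<gamma>)" using radius rate by (simp add: field_simps)
  then have "2 * C / R < 1 - \<gamma>" using R_pos by (simp add: field_simps)
  then show ?thesis by linarith
qed

lemma contraction_rate: "0 < contraction_rate" "contraction_rate < 1"
proof -
  have R\<beta>: "0 < R * \<beta>" using R_pos \<beta>_pos by simp
  have g: "0 \<le> \<gamma> + 2 * C / R" using rate C_pos R_pos by simp
  have "0 < 2 + R * \<beta> * (\<gamma> + 2 * C / R)"
    using mult_nonneg_nonneg[OF less_imp_le[OF R\<beta>] g] by linarith
  then have "0 < (2 + R * \<beta> * (\<gamma> + 2 * C / R)) / (2 + R * \<beta>)"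
    using R\<beta> by (intro divide_pos_pos) auto
  then show "0 < contraction_rate" by (simp add: contraction_rate_def)
  have "R * \<beta> * (\<gamma> + 2 * C / R) < R * \<beta> * 1"
    using R\<beta> relaxed_rate by (intro mult_strict_left_mono) auto
  then have "(2 + R * \<beta> * (\<gamma> + 2 * C / R)) / (2 + R * \<beta>) < 1"
    using R\<beta> by simp
  then show "contraction_rate < 1" using mass_pos by (simp add: contraction_rate_def)
qed

lemma dominatedD: "dominated c \<phi> \<Longrightarrow> \<phi> \<in> borel_measurable S"
  "dominated c \<phi> \<Longrightarrow> x \<in> space S \<Longrightarrow> \<bar>\<phi> x\<bar> \<le> c * (1 + V x)"
  by (auto simp: dominated_def)

lemma dominated_nonneg: "dominated c \<phi> \<Longrightarrow> 0 \<le> c"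
proof -
  assume d: "dominated c \<phi>"
  obtain x where x: "x \<in> space S" using space_not_empty by blast
  have "0 \<le> c * (1 + V x)" using dominatedD(2)[OF d x] by linarith
  then show "0 \<le> c" using V_nonneg[OF x] by (simp add: zero_le_mult_iff)
qed

lemma integrable_const_plus_V: "x \<in> space S \<Longrightarrow> integrable (K x) (\<lambda>y. c * (1 + d * V y))"
  using V_integrable[of x] prob_space.finite_measure[OF prob_K[of x]]
  by (simp add: finite_measure.integrable_const)

lemma integrable_dominated:
  assumes "dominated c \<phi>" and x: "x \<in> space S" shows "integrable (K x) \<phi>"
  using integrable_const_plus_V[OF x, of c 1] measurable_K[OF x dominatedD(1)[OF assms(1)]]
  by (rule Bochner_Integration.integrable_bound)
     (use dominatedD(2)[OF assms(1)] in \<open>fastforce simp: space_K[OF x]\<close>)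

lemma transition_const: "x \<in> space S \<Longrightarrow> transition (\<lambda>_. c) x = c"
  using prob_K[of x] by (simp add: transition_def prob_space.prob_space)

lemma transition_weight_le:
  assumes x: "x \<in> space S" and "0 \<le> d"
  shows "transition (\<lambda>y. 1 + d * V y) x \<le> 1 + d * (\<gamma> * V x + C)"
proof -
  interpret prob_space "K x" using x by (rule prob_K)
  have "transition (\<lambda>y. 1 + d * V y) x = 1 + d * (\<integral>y. V y \<partial>K x)"
    unfolding transition_def using V_integrable[OF x]
    by (subst Bochner_Integration.integral_add) (auto simp: prob_space)
  with drift[OF x] \<open>0 \<le> d\<close> show ?thesis by (simp add: mult_left_mono)
qed

lemma transition_dominated:
  assumes d: "dominated c \<phi>" shows "dominated (c * (1 + C)) (transition \<phi>)"
  unfolding dominated_def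
proof safe
  have "(\<lambda>x. integral\<^sup>L (K x) \<phi>) \<in> borel_measurable S"
    using measurable_compose[OF measurable_prob_algebraD[OF kernel]
      integral_measurable_subprob_algebra[OF dominatedD(1)[OF d]]] .
  then show "transition \<phi> \<in> borel_measurable S"
    by (simp add: transition_def[abs_def])
next
  fix x assume x: "x \<in> space S"
  note c = dominated_nonneg[OF d]
  have "\<bar>transition \<phi> x\<bar> \<le> (\<integral>y. \<bar>\<phi> y\<bar> \<partial>K x)"
    unfolding transition_def by (rule integral_abs_bound)
  also have "\<dots> \<le> (\<integral>y. c * (1 + 1 * V y) \<partial>K x)"
    using integrable_dominated[OF d x] integrable_const_plus_V[OF x, of c 1] dominatedD(2)[OF d]
    by (intro integral_mono) (auto simp: space_K[OF x])
  also have "\<dots> \<le> c * (1 + 1 * (\<gamma> * V x + C))"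
    using transition_weight_le[OF x, of 1] c
    by (simp add: transition_def mult_left_mono)
  also have "\<dots> \<le> c * ((1 + C) * (1 + V x))"
  proof (rule mult_left_mono[OF _ c])
    have "\<gamma> * V x \<le> V x" "0 \<le> C * V x"
      using rate V_nonneg[OF x] C_pos mult_right_mono[of \<gamma> 1 "V x"] by auto
    then show "1 + 1 * (\<gamma> * V x + C) \<le> (1 + C) * (1 + V x)"
      by (simp add: algebra_simps)
  qed
  finally show "\<bar>transition \<phi> x\<bar> \<le> c * (1 + C) * (1 + V x)" by (simp add: mult.assoc)
qed

lemma iterate_dominated:
  "dominated c \<phi> \<Longrightarrow> dominated (c * (1 + C) ^ n) ((transition ^^ n) \<phi>)"
proof (induction n)
  case (Suc n)
  then show ?case using transition_dominated[of "c * (1 + C) ^ n" "(transition ^^ n) \<phi>"]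
    by (simp add: algebra_simps)
qed simp

lemma weight_ge_1: "x \<in> space S \<Longrightarrow> 1 \<le> weight x"
  using V_nonneg \<beta>_pos by (simp add: weight_def)

lemma weight_dominated: "dominated (max 1 \<beta>) weight"
  unfolding dominated_def weight_def
proof safe
  fix x assume x: "x \<in> space S"
  have "\<beta> * V x \<le> max 1 \<beta> * V x"
    using V_nonneg[OF x] by (intro mult_right_mono) auto
  moreover have "0 \<le> \<beta> * V x" using V_nonneg[OF x] \<beta>_pos by simp
  ultimately show "\<bar>1 + \<beta> * V x\<bar> \<le> max 1 \<beta> * (1 + V x)"
    by (simp add: distrib_left)
qed measurable

lemma transition_weight: "x \<in> space S \<Longrightarrow> transition weight x \<le> 1 + \<beta> * (\<gamma> * V x + C)"
  using transition_weight_le[of x \<beta>] \<beta>_pos by (simp add: weight_def[abs_def])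

lemma minorant_integral_le:
  assumes x: "x \<in> space S" "V x \<le> R" and d: "dominated c \<psi>"
  shows "integrable \<nu> \<psi>" "(\<And>y. y \<in> space S \<Longrightarrow> 0 \<le> \<psi> y) \<Longrightarrow> (\<integral>y. \<psi> y \<partial>\<nu>) \<le> transition \<psi> x"
  using integral_mono_setwise[of \<nu> "K x" \<psi>] minorization[OF x] sets_K[OF x(1)] space_K[OF x(1)]
    sets_minorant integrable_dominated[OF d x(1)] by (auto simp: transition_def)

lemma dominated_lincomb:
  assumes "dominated c \<phi>" "dominated d \<psi>"
  shows "dominated (\<bar>a\<bar> * c + \<bar>b\<bar> * d) (\<lambda>x. a * \<phi> x + b * \<psi> x)"
  unfolding dominated_def
proof safe
  show "(\<lambda>x. a * \<phi> x + b * \<psi> x) \<in> borel_measurable S"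
    using assms[THEN dominatedD(1)] by measurable
  fix x assume x: "x \<in> space S"
  have "\<bar>a * \<phi> x + b * \<psi> x\<bar> \<le> \<bar>a\<bar> * \<bar>\<phi> x\<bar> + \<bar>b\<bar> * \<bar>\<psi> x\<bar>"
    by (metis abs_mult abs_triangle_ineq)
  also have "\<dots> \<le> \<bar>a\<bar> * (c * (1 + V x)) + \<bar>b\<bar> * (d * (1 + V x))"
    using assms[THEN dominatedD(2)[OF _ x]] by (intro add_mono mult_left_mono) auto
  finally show "\<bar>a * \<phi> x + b * \<psi> x\<bar> \<le> (\<bar>a\<bar> * c + \<bar>b\<bar> * d) * (1 + V x)"
    by (simp add: algebra_simps)
qed

lemma transition_lincomb:
  assumes "dominated c \<phi>" "dominated d \<psi>" "x \<in> space S"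
  shows "transition (\<lambda>x. a * \<phi> x + b * \<psi> x) x = a * transition \<phi> x + b * transition \<psi> x"
  using integrable_dominated[OF assms(1,3)] integrable_dominated[OF assms(2,3)]
  by (simp add: transition_def)

text \<open>
  Subtracting the common part \<open>\<nu>\<close> from the kernel leaves a nonnegative measure, so \<open>|\<psi>| \<le> L weight\<close>
  can be integrated against it; the bound improves by \<open>L mass\<close> because \<open>weight \<ge> 1\<close>. In a difference of
  two transitions the subtracted term \<open>\<integral>\<psi> d\<nu>\<close> cancels.
\<close>

lemma minorant_gain:
  assumes x: "x \<in> space S" "V x \<le> R" and d: "dominated c \<psi>"
    and L: "\<And>x. x \<in> space S \<Longrightarrow> \<bar>\<psi> x\<bar> \<le> L * weight x"
  shows "\<bar>transition \<psi> x - (\<integral>y. \<psi> y \<partial>\<nu>)\<bar> \<le> L * (transition weight x - mass)"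
proof -
  interpret finite_measure \<nu> by (rule finite_minorant)
  have L0: "0 \<le> L"
    using L[OF x(1)] weight_ge_1[OF x(1)] by (smt (verit) mult_neg_pos)
  note [simp] = sets_eq_imp_space_eq[OF sets_minorant]
  have key: "\<bar>s\<bar> = 1 \<Longrightarrow> L * (\<integral>y. weight y \<partial>\<nu>) + s * (\<integral>y. \<psi> y \<partial>\<nu>) \<le> L * transition weight x + s * transition \<psi> x" for s
  proof -
    assume s: "\<bar>s\<bar> = 1"
    have "(\<integral>y. L * weight y + s * \<psi> y \<partial>\<nu>) \<le> transition (\<lambda>y. L * weight y + s * \<psi> y) x"
    proof (rule minorant_integral_le(2)[OF x dominated_lincomb[OF weight_dominated d]])
      fix y assume "y \<in> space S"
      then have "\<bar>s * \<psi> y\<bar> \<le> L * weight y" using L[of y] s by (simp add: abs_mult)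
      then show "0 \<le> L * weight y + s * \<psi> y" by linarith
    qed
    then show ?thesis
      using minorant_integral_le(1)[OF x d] minorant_integral_le(1)[OF x weight_dominated]
        transition_lincomb[OF weight_dominated d x(1)] by simp
  qed
  have "mass = (\<integral>y. 1 \<partial>\<nu>)" by (simp add: mass_def)
  also have "\<dots> \<le> (\<integral>y. weight y \<partial>\<nu>)"
    using minorant_integral_le(1)[OF x weight_dominated] weight_ge_1 by (intro integral_mono) auto
  finally have "L * mass \<le> L * (\<integral>y. weight y \<partial>\<nu>)" using L0 by (rule mult_left_mono)
  with key[of 1] key[of "-1"] show ?thesis by (auto simp: right_diff_distrib)
qed

lemma transition_abs_le:
  assumes x: "x \<in> space S" and d: "dominated c \<psi>" and L: "\<And>x. x \<in> space S \<Longrightarrow> \<bar>\<psi> x\<bar> \<le> L * weight x"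
  shows "\<bar>transition \<psi> x\<bar> \<le> L * transition weight x"
proof -
  have "\<bar>transition \<psi> x\<bar> \<le> (\<integral>y. \<bar>\<psi> y\<bar> \<partial>K x)"
    unfolding transition_def by (rule integral_abs_bound)
  also have "\<dots> \<le> (\<integral>y. L * weight y \<partial>K x)"
    using integrable_dominated[OF d x] integrable_dominated[OF weight_dominated x] L
    by (intro integral_mono) (auto simp: space_K[OF x])
  finally show ?thesis by (simp add: transition_def)
qed

text \<open>
  Let \<open>s = V x + V y\<close>. If \<open>s \<ge> R\<close>, the drift alone contracts. If \<open>s < R\<close>, both points lie below level
  \<open>R\<close> and the minorization reduces the constant part of the weight, while the drift reduces the rest.
\<close>

lemma contraction_centred:
  assumes d: "dominated c \<psi>" and L: "\<And>x. x \<in> space S \<Longrightarrow> \<bar>\<psi> x\<bar> \<le> L * weight x"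
    and x: "x \<in> space S" and y: "y \<in> space S"
  shows "transition \<psi> x - transition \<psi> y \<le> contraction_rate * (L * (weight x + weight y))"
proof -
  define s where "s = V x + V y"
  define g where "g = \<gamma> + 2 * C / R"
  have L0: "0 \<le> L"
    using L[OF x] weight_ge_1[OF x] by (smt (verit) mult_neg_pos)
  have s0: "0 \<le> s" using V_nonneg x y by (simp add: s_def)
  have \<beta>C: "2 * \<beta> * C = mass" using C_pos by (simp add: \<beta>_def)
  have w: "transition weight x + transition weight y \<le> 2 + \<beta> * \<gamma> * s + 2 * \<beta> * C"
    using transition_weight[OF x] transition_weight[OF y] by (simp add: s_def algebra_simps)
  have ww: "weight x + weight y = 2 + \<beta> * s" by (simp add: weight_def s_def algebra_simps)
  have g: "(2 + R * \<beta> * g) / (2 + R * \<beta>) \<le> contraction_rate" "0 \<le> g" "g < 1"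
    using relaxed_rate rate C_pos R_pos by (auto simp: contraction_rate_def g_def)
  have pos: "0 < 2 + R * \<beta>" using R_pos \<beta>_pos by (simp add: add_pos_pos)
  have "transition \<psi> x - transition \<psi> y \<le> L * (contraction_rate * (2 + \<beta> * s))"
  proof (cases "R \<le> s")
    case True
    have "transition \<psi> x - transition \<psi> y \<le> L * transition weight x + L * transition weight y"
      using transition_abs_le[OF x d L] transition_abs_le[OF y d L] by linarith
    also have "\<dots> \<le> L * (2 + \<beta> * \<gamma> * s + 2 * \<beta> * C)"
      using mult_left_mono[OF w L0] by (simp add: distrib_left)
    also have "\<dots> \<le> L * (contraction_rate * (2 + \<beta> * s))"
    proof (rule mult_left_mono[OF _ L0])
      have "2 * C \<le> (2 * C / R) * s"
        using True R_pos C_pos by (simp add: field_simps)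
      then have "\<beta> * (2 * C) \<le> \<beta> * ((2 * C / R) * s)"
        using \<beta>_pos by (intro mult_left_mono) auto
      then have "2 + \<beta> * \<gamma> * s + 2 * \<beta> * C \<le> 2 + \<beta> * g * s"
        by (simp add: g_def algebra_simps)
      also have "\<dots> \<le> (2 + R * \<beta> * g) / (2 + R * \<beta>) * (2 + \<beta> * s)"
      proof -
        \<comment> \<open>after multiplying out, the two sides of the claim differ by exactly this product\<close>
        have "0 \<le> 2 * \<beta> * ((1 - g) * (s - R))"
          using g \<beta>_pos True by simp
        then have "(2 + \<beta> * g * s) * (2 + R * \<beta>) \<le> (2 + R * \<beta> * g) * (2 + \<beta> * s)"
          by (simp add: algebra_simps)
        then show ?thesis using pos by (simp add: field_simps)
      qed
      also have "\<dots> \<le> contraction_rate * (2 + \<beta> * s)"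
        using g \<beta>_pos s0 by (intro mult_right_mono) auto
      finally show "2 + \<beta> * \<gamma> * s + 2 * \<beta> * C \<le> contraction_rate * (2 + \<beta> * s)" .
    qed
    finally show ?thesis .
  next
    case False
    then have "V x \<le> R" "V y \<le> R" using V_nonneg[OF x] V_nonneg[OF y] by (auto simp: s_def)
    then have "transition \<psi> x - transition \<psi> y
        \<le> L * (transition weight x - mass) + L * (transition weight y - mass)"
      using minorant_gain[OF x _ d L] minorant_gain[OF y _ d L] by linarith
    also have "\<dots> \<le> L * (2 + \<beta> * \<gamma> * s + 2 * \<beta> * C - 2 * mass)"
      using mult_left_mono[OF w L0] by (simp add: algebra_simps)
    also have "\<dots> \<le> L * (contraction_rate * (2 + \<beta> * s))"
    proof (rule mult_left_mono[OF _ L0])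
      have "g * (2 + R * \<beta>) \<le> 2 + R * \<beta> * g"
        using g by (simp add: algebra_simps)
      then have "g \<le> (2 + R * \<beta> * g) / (2 + R * \<beta>)"
        using pos by (simp add: pos_le_divide_eq)
      moreover have "\<gamma> \<le> g" using C_pos R_pos by (simp add: g_def)
      ultimately have "\<gamma> * (\<beta> * s) \<le> contraction_rate * (\<beta> * s)"
        using g(1) \<beta>_pos s0 by (intro mult_right_mono) auto
      moreover have "2 * (1 - mass / 2) \<le> 2 * contraction_rate"
        unfolding contraction_rate_def by (intro mult_left_mono) auto
      ultimately show "2 + \<beta> * \<gamma> * s + 2 * \<beta> * C - 2 * mass \<le> contraction_rate * (2 + \<beta> * s)"
        unfolding \<beta>C by (simp add: algebra_simps)
    qed
    finally show ?thesis .
  qed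
  then show ?thesis by (simp add: ww algebra_simps)
qed

text \<open>
  A weighted oscillation bound is a weighted sup bound after adding a constant: the intervals
  \<open>[- L weight x - \<phi> x, L weight x - \<phi> x]\<close> intersect pairwise, hence all of them have a common point. As
  the transition operator fixes constants, it suffices to contract centred functions.
\<close>

lemma centring:
  assumes osc: "\<And>x y. x \<in> space S \<Longrightarrow> y \<in> space S \<Longrightarrow> \<phi> x - \<phi> y \<le> L * (weight x + weight y)"
  obtains k where "\<And>x. x \<in> space S \<Longrightarrow> \<bar>\<phi> x + k\<bar> \<le> L * weight x"
proof
  define k where "k = (INF x\<in>space S. L * weight x - \<phi> x)"
  fix x assume x: "x \<in> space S"
  have below: "- (L * weight y) - \<phi> y \<le> L * weight z - \<phi> z" if "y \<in> space S" "z \<in> space S" for y z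
    using osc[OF that(2,1)] by (simp add: algebra_simps)
  have "k \<le> L * weight x - \<phi> x"
    unfolding k_def using below[OF x] x by (intro cINF_lower) (auto intro!: bdd_belowI2)
  moreover have "- (L * weight x) - \<phi> x \<le> k"
    unfolding k_def using below[OF x] space_not_empty by (intro cINF_greatest) auto
  ultimately show "\<bar>\<phi> x + (INF x\<in>space S. L * weight x - \<phi> x)\<bar> \<le> L * weight x"
    unfolding k_def[symmetric] by linarith
qed

lemma dominated_const: "dominated \<bar>c\<bar> (\<lambda>_. c)"
  using V_nonneg by (auto simp: dominated_def mult_le_cancel_left1)

text \<open>
  The heart of Harris's theorem: the transition operator contracts the oscillation weighted by
  \<open>weight\<close>, with a rate that depends on the drift and minorization constants only.
\<close>

lemma contraction:
  assumes d: "dominated c \<phi>"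
    and osc: "\<And>x y. x \<in> space S \<Longrightarrow> y \<in> space S \<Longrightarrow> \<phi> x - \<phi> y \<le> L * (weight x + weight y)"
    and x: "x \<in> space S" and y: "y \<in> space S"
  shows "transition \<phi> x - transition \<phi> y \<le> contraction_rate * L * (weight x + weight y)"
proof -
  obtain k where k: "\<And>x. x \<in> space S \<Longrightarrow> \<bar>\<phi> x + k\<bar> \<le> L * weight x"
    using centring[OF osc] by blast
  note lin = dominated_lincomb[OF d dominated_const[of k], of 1 1]
  have "transition (\<lambda>x. 1 * \<phi> x + 1 * k) z = transition \<phi> z + k" if "z \<in> space S" for z
    using transition_lincomb[OF d dominated_const[of k] that, of 1 1] transition_const[OF that]
    by simp
  with contraction_centred[OF lin, of L, OF _ x y] k x y show ?thesis
    by (simp add: mult.assoc)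
qed

lemma iterate_contraction:
  assumes d: "dominated c \<phi>"
    and osc: "\<And>x y. x \<in> space S \<Longrightarrow> y \<in> space S \<Longrightarrow> \<phi> x - \<phi> y \<le> L * (weight x + weight y)"
    and "x \<in> space S" "y \<in> space S"
  shows "(transition ^^ n) \<phi> x - (transition ^^ n) \<phi> y \<le> contraction_rate ^ n * L * (weight x + weight y)"
  using assms(3,4)
proof (induction n arbitrary: x y)
  case (Suc n)
  from contraction[OF iterate_dominated[OF d] Suc.IH Suc.prems] show ?case
    by (simp add: mult.assoc)
qed (use osc in auto)

definition bound_const :: real where
  "bound_const = max 1 (1 / \<beta>) * (2 + \<beta> * (2 + C)) / (1 - contraction_rate)"

lemma bound_const_pos: "0 < bound_const"
  using contraction_rate \<beta>_pos C_pos unfolding bound_const_def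
  by (intro divide_pos_pos mult_pos_pos) (auto intro!: add_pos_pos)

lemma dominated_osc:
  assumes d: "dominated c \<phi>" and x: "x \<in> space S" and y: "y \<in> space S"
  shows "\<phi> x - \<phi> y \<le> c * max 1 (1 / \<beta>) * (weight x + weight y)"
proof -
  have le: "1 + V z \<le> max 1 (1 / \<beta>) * weight z" if z: "z \<in> space S" for z
  proof -
    have "V z = (1 / \<beta>) * (\<beta> * V z)" using \<beta>_pos by simp
    also have "\<dots> \<le> max 1 (1 / \<beta>) * (\<beta> * V z)"
      using \<beta>_pos V_nonneg[OF z] by (intro mult_right_mono) auto
    finally show ?thesis by (simp add: weight_def distrib_left)
  qed
  have "\<phi> x - \<phi> y \<le> c * (1 + V x) + c * (1 + V y)"
    using dominatedD(2)[OF d x] dominatedD(2)[OF d y] by linarith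
  also have "\<dots> \<le> c * (max 1 (1 / \<beta>) * weight x) + c * (max 1 (1 / \<beta>) * weight y)"
    using le[OF x] le[OF y] dominated_nonneg[OF d] by (intro add_mono mult_left_mono) auto
  finally show ?thesis by (simp add: algebra_simps)
qed

text \<open>
  The one-step difference of the iterates at \<open>x\<close> averages oscillations of the \<open>n\<close>-th iterate between
  \<open>x\<close> and points drawn from \<open>K x\<close>, so it inherits the decay of the oscillation.
\<close>

lemma iterate_increment:
  assumes d: "dominated c \<phi>" and x: "x \<in> space S"
  shows "\<bar>(transition ^^ Suc n) \<phi> x - (transition ^^ n) \<phi> x\<bar>
    \<le> (c * (bound_const * (1 - contraction_rate)) * (1 + V x)) * contraction_rate ^ n"
proof -
  interpret prob_space "K x" using x by (rule prob_K)
  define \<psi> where "\<psi> = (transition ^^ n) \<phi>"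
  define L where "L = contraction_rate ^ n * (c * max 1 (1 / \<beta>))"
  have L0: "0 \<le> L" using contraction_rate dominated_nonneg[OF d] by (simp add: L_def)
  have \<psi>: "dominated (c * (1 + C) ^ n) \<psi>" unfolding \<psi>_def using d by (rule iterate_dominated)
  have osc: "\<psi> y - \<psi> z \<le> L * (weight y + weight z)" if "y \<in> space S" "z \<in> space S" for y z
    unfolding \<psi>_def L_def using iterate_contraction[OF d dominated_osc[OF d] that]
    by (simp add: mult.assoc)
  note int = integrable_dominated[OF \<psi> x] integrable_dominated[OF weight_dominated x]
  have "\<bar>transition \<psi> x - \<psi> x\<bar> = \<bar>\<integral>y. \<psi> y - \<psi> x \<partial>K x\<bar>"
    using int by (simp add: transition_def prob_space)
  also have "\<dots> \<le> (\<integral>y. \<bar>\<psi> y - \<psi> x\<bar> \<partial>K x)" by (rule integral_abs_bound)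
  also have "\<dots> \<le> (\<integral>y. L * (weight x + weight y) \<partial>K x)"
    using int osc[OF x] osc[OF _ x]
    by (intro integral_mono) (auto simp: space_K[OF x] abs_le_iff add.commute)
  also have "\<dots> = L * (weight x + transition weight x)"
    using int by (simp add: transition_def prob_space)
  also have "\<dots> \<le> L * ((2 + \<beta> * (2 + C)) * (1 + V x))"
  proof (rule mult_left_mono[OF _ L0])
    have "\<beta> * (\<gamma> * V x) \<le> \<beta> * (1 * V x)"
      using rate V_nonneg[OF x] \<beta>_pos by (intro mult_left_mono mult_right_mono) auto
    moreover have "0 \<le> \<beta> * V x" "0 \<le> \<beta> * C * V x" using V_nonneg[OF x] \<beta>_pos C_pos by auto
    ultimately show "weight x + transition weight x \<le> (2 + \<beta> * (2 + C)) * (1 + V x)"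
      using transition_weight[OF x] V_nonneg[OF x] \<beta>_pos by (simp add: weight_def algebra_simps)
  qed
  also have "\<dots> = (c * (bound_const * (1 - contraction_rate)) * (1 + V x)) * contraction_rate ^ n"
    using contraction_rate by (simp add: bound_const_def L_def)
  finally show ?thesis by (simp add: \<psi>_def)
qed

text \<open>
  The iterates converge to a constant function, so any base point defines its value.
\<close>

definition limit :: "('a \<Rightarrow> real) \<Rightarrow> real" where
  "limit \<phi> = lim (\<lambda>n. (transition ^^ n) \<phi> (SOME x. x \<in> space S))"

lemma iterate_tendsto_limit:
  assumes d: "dominated c \<phi>" and x: "x \<in> space S"
  shows "(\<lambda>n. (transition ^^ n) \<phi> x) \<longlonglongrightarrow> limit \<phi>"
    and "\<bar>(transition ^^ n) \<phi> x - limit \<phi>\<bar> \<le> c * bound_const * contraction_rate ^ n * (1 + V x)"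
proof -
  define x0 where "x0 = (SOME x. x \<in> space S)"
  have x0: "x0 \<in> space S" unfolding x0_def using space_not_empty by (metis all_not_in_conv someI)
  note r = less_imp_le[OF contraction_rate(1)] contraction_rate(2)
  have conv: "\<exists>l. (\<lambda>n. (transition ^^ n) \<phi> z) \<longlonglongrightarrow> l \<and>
    (\<forall>n. \<bar>(transition ^^ n) \<phi> z - l\<bar> \<le> c * bound_const * contraction_rate ^ n * (1 + V z))"
    if z: "z \<in> space S" for z
  proof -
    obtain l where l: "(\<lambda>n. (transition ^^ n) \<phi> z) \<longlonglongrightarrow> l"
      "\<And>n. \<bar>(transition ^^ n) \<phi> z - l\<bar> \<le> (c * (bound_const * (1 - contraction_rate)) * (1 + V z))
         / (1 - contraction_rate) * contraction_rate ^ n"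
      using geometric_increments_converge[of contraction_rate, OF r iterate_increment[OF d z]] by blast
    have "(c * (bound_const * (1 - contraction_rate)) * (1 + V z)) / (1 - contraction_rate)
      * contraction_rate ^ n = c * bound_const * contraction_rate ^ n * (1 + V z)" for n
      using r by simp
    with l show ?thesis by metis
  qed
  have lim0: "(\<lambda>n. (transition ^^ n) \<phi> x0) \<longlonglongrightarrow> limit \<phi>"
    using conv[OF x0] limI unfolding limit_def x0_def[symmetric] by blast
  obtain l where l: "(\<lambda>n. (transition ^^ n) \<phi> x) \<longlonglongrightarrow> l"
    "\<And>n. \<bar>(transition ^^ n) \<phi> x - l\<bar> \<le> c * bound_const * contraction_rate ^ n * (1 + V x)"
    using conv[OF x] by blast
  define B where "B = c * max 1 (1 / \<beta>) * (weight x + weight x0)"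
  have "(\<lambda>n. (transition ^^ n) \<phi> x - (transition ^^ n) \<phi> x0) \<longlonglongrightarrow> 0"
  proof (rule Lim_null_comparison)
    have bd: "\<bar>(transition ^^ n) \<phi> x - (transition ^^ n) \<phi> x0\<bar> \<le> contraction_rate ^ n * B" for n
      using iterate_contraction[OF d dominated_osc[OF d] x x0, of n]
        iterate_contraction[OF d dominated_osc[OF d] x0 x, of n]
      by (auto simp: abs_le_iff B_def mult.assoc add.commute)
    then show "\<forall>\<^sub>F n in sequentially.
        norm ((transition ^^ n) \<phi> x - (transition ^^ n) \<phi> x0) \<le> contraction_rate ^ n * B"
      by simp
    show "(\<lambda>n. contraction_rate ^ n * B) \<longlonglongrightarrow> 0"
      using LIMSEQ_realpow_zero[OF r] tendsto_mult_left_zero by blast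
  qed
  moreover have "(\<lambda>n. (transition ^^ n) \<phi> x - (transition ^^ n) \<phi> x0) \<longlonglongrightarrow> l - limit \<phi>"
    using l lim0 by (intro tendsto_diff)
  ultimately have "l - limit \<phi> = 0" by (rule LIMSEQ_unique[symmetric])
  then have "l = limit \<phi>" by simp
  with l show "(\<lambda>n. (transition ^^ n) \<phi> x) \<longlonglongrightarrow> limit \<phi>"
    "\<bar>(transition ^^ n) \<phi> x - limit \<phi>\<bar> \<le> c * bound_const * contraction_rate ^ n * (1 + V x)" by auto
qed

lemma limit_eqI:
  "dominated c \<phi> \<Longrightarrow> (\<And>x. x \<in> space S \<Longrightarrow> (\<lambda>n. (transition ^^ n) \<phi> x) \<longlonglongrightarrow> l) \<Longrightarrow> limit \<phi> = l"
  by (metis iterate_tendsto_limit(1) space_not_empty LIMSEQ_unique ex_in_conv)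

lemma limit_transition:
  assumes d: "dominated c \<phi>" shows "limit (transition \<phi>) = limit \<phi>"
proof (rule limit_eqI[OF transition_dominated[OF d]])
  fix x assume "x \<in> space S"
  from LIMSEQ_Suc[OF iterate_tendsto_limit(1)[OF d this]]
  show "(\<lambda>n. (transition ^^ n) (transition \<phi>) x) \<longlonglongrightarrow> limit \<phi>"
    by (simp only: funpow_Suc_right o_def)
qed

lemma iterate_lincomb:
  assumes "dominated c \<phi>" "dominated d \<psi>" "x \<in> space S"
  shows "(transition ^^ n) (\<lambda>x. a * \<phi> x + b * \<psi> x) x = a * (transition ^^ n) \<phi> x + b * (transition ^^ n) \<psi> x"
  using assms(3)
proof (induction n arbitrary: x)
  case (Suc n)
  have "(transition ^^ Suc n) (\<lambda>x. a * \<phi> x + b * \<psi> x) x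
    = transition (\<lambda>x. a * (transition ^^ n) \<phi> x + b * (transition ^^ n) \<psi> x) x"
    unfolding funpow.simps o_def transition_def[of _ x]
    by (intro Bochner_Integration.integral_cong) (auto simp: space_K[OF Suc.prems] Suc.IH)
  with transition_lincomb[OF iterate_dominated[OF assms(1)] iterate_dominated[OF assms(2)] Suc.prems]
  show ?case by simp
qed simp

lemma limit_lincomb:
  assumes "dominated c \<phi>" "dominated d \<psi>"
  shows "limit (\<lambda>x. a * \<phi> x + b * \<psi> x) = a * limit \<phi> + b * limit \<psi>"
  using iterate_tendsto_limit(1)[OF assms(1)] iterate_tendsto_limit(1)[OF assms(2)]
  by (intro limit_eqI[OF dominated_lincomb[OF assms]])
     (auto simp: iterate_lincomb[OF assms] intro!: tendsto_intros)

lemma iterate_nonneg: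
  "(\<And>x. x \<in> space S \<Longrightarrow> 0 \<le> \<phi> x) \<Longrightarrow> x \<in> space S \<Longrightarrow> 0 \<le> (transition ^^ n) \<phi> x"
proof (induction n arbitrary: x)
  case (Suc n)
  then show ?case
    by (auto simp: transition_def[of _ x] space_K intro!: integral_nonneg_AE AE_I2)
qed simp

lemma limit_nonneg:
  assumes "dominated c \<phi>" "\<And>x. x \<in> space S \<Longrightarrow> 0 \<le> \<phi> x" shows "0 \<le> limit \<phi>"
proof -
  obtain x where x: "x \<in> space S" using space_not_empty by blast
  show ?thesis
    using iterate_tendsto_limit(1)[OF assms(1) x] iterate_nonneg[OF assms(2) x]
    by (intro LIMSEQ_le_const) auto
qed

lemma limit_const: "limit (\<lambda>_. c) = c"
proof (rule limit_eqI[OF dominated_const])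
  have "x \<in> space S \<Longrightarrow> (transition ^^ n) (\<lambda>_. c) x = c" for n x
  proof (induction n arbitrary: x)
    case (Suc n)
    then have "(transition ^^ Suc n) (\<lambda>_. c) x = transition (\<lambda>_. c) x"
      by (auto simp add: transition_def[of _ x] space_K simp del: lebesgue_integral_const intro!: Bochner_Integration.integral_cong)
    with Suc.prems show ?case by (simp add: transition_const)
  qed simp
  then show "x \<in> space S \<Longrightarrow> (\<lambda>n. (transition ^^ n) (\<lambda>_. c) x) \<longlonglongrightarrow> c" for x by simp
qed

text \<open>
  For a fixed number of steps this is dominated convergence for the kernels. It survives the passage to
  the limit because the distance of the \<open>n\<close>-th iterate from its limit depends on the function only
  through its bound \<open>c\<close>.
\<close>

lemma limit_dominated_convergence:
  assumes f: "\<And>i. dominated c (f i)" and g: "dominated c g"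
    and conv: "\<And>x. x \<in> space S \<Longrightarrow> (\<lambda>i. f i x) \<longlonglongrightarrow> g x"
  shows "(\<lambda>i. limit (f i)) \<longlonglongrightarrow> limit g"
proof -
  have it: "x \<in> space S \<Longrightarrow> (\<lambda>i. (transition ^^ n) (f i) x) \<longlonglongrightarrow> (transition ^^ n) g x" for n x
  proof (induction n arbitrary: x)
    case (Suc n)
    let ?c = "c * (1 + C) ^ n"
    have "(\<lambda>i. \<integral>y. (transition ^^ n) (f i) y \<partial>K x) \<longlonglongrightarrow> (\<integral>y. (transition ^^ n) g y \<partial>K x)"
    proof (rule integral_dominated_convergence)
      show "integrable (K x) (\<lambda>y. ?c * (1 + 1 * V y))" by (rule integrable_const_plus_V[OF Suc.prems])
      show "(transition ^^ n) g \<in> borel_measurable (K x)" "(transition ^^ n) (f i) \<in> borel_measurable (K x)" for i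
        using iterate_dominated[OF f] iterate_dominated[OF g] Suc.prems
        by (blast intro: measurable_K dominatedD(1))+
      show "AE y in K x. (\<lambda>i. (transition ^^ n) (f i) y) \<longlonglongrightarrow> (transition ^^ n) g y"
        using Suc by (auto simp: space_K)
      show "AE y in K x. norm ((transition ^^ n) (f i) y) \<le> ?c * (1 + 1 * V y)" for i
        using dominatedD(2)[OF iterate_dominated[OF f]] Suc.prems by (auto simp: space_K)
    qed
    then show ?case by (simp add: transition_def[of _ x])
  qed (use conv in auto)
  obtain x where x: "x \<in> space S" using space_not_empty by blast
  show ?thesis
  proof (rule LIMSEQ_I)
    fix e :: real assume e: "0 < e"
    define B where "B = c * bound_const * (1 + V x)"
    have "(\<lambda>n. B * contraction_rate ^ n) \<longlonglongrightarrow> B * 0"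
      using contraction_rate by (intro tendsto_mult tendsto_const LIMSEQ_realpow_zero) auto
    from LIMSEQ_D[OF this, of "e / 3"] obtain n where "norm (B * contraction_rate ^ n - B * 0) < e / 3"
      using e by auto
    then have n: "B * contraction_rate ^ n < e / 3" by simp
    have close: "\<bar>(transition ^^ n) \<phi> x - limit \<phi>\<bar> < e / 3" if "dominated c \<phi>" for \<phi>
      using iterate_tendsto_limit(2)[OF that x, of n] n by (simp add: B_def mult.assoc mult.commute mult.left_commute)
    obtain N where N: "\<And>i. i \<ge> N \<Longrightarrow> norm ((transition ^^ n) (f i) x - (transition ^^ n) g x) < e / 3"
      using LIMSEQ_D[OF it[OF x], of "e / 3"] e by (metis divide_pos_pos zero_less_numeral)
    have "norm (limit (f i) - limit g) < e" if "i \<ge> N" for i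
      using close[OF f, of i] close[OF g] N[OF that] by (simp add: abs_if split: if_splits)
    then show "\<exists>N. \<forall>i\<ge>N. norm (limit (f i) - limit g) < e" by blast
  qed
qed

text \<open>
  The functional \<open>limit\<close> is linear, positive and normalized, and dominated convergence makes its values
  on indicators countably additive; so it is integration against a probability measure.
\<close>

definition stationary :: "'a measure" where
  "stationary = measure_of (space S) (sets S) (\<lambda>A. ennreal (limit (indicator A)))"

lemma dominated_indicator: "A \<in> sets S \<Longrightarrow> dominated 1 (indicator A)"
  using V_nonneg by (auto simp: dominated_def indicator_def)

lemma sets_stationary [simp]: "sets stationary = sets S"
  by (simp add: stationary_def)

lemma space_stationary [simp]: "space stationary = space S"
  by (simp add: stationary_def)

lemma emeasure_stationary:
  assumes A: "A \<in> sets S" shows "emeasure stationary A = ennreal (limit (indicator A))"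
proof -
  let ?m = "\<lambda>A. ennreal (limit (indicator A))"
  have pos: "positive (sets S) ?m"
    using limit_const[of 0] by (simp add: positive_def indicator_def[abs_def])
  have add: "additive (sets S) ?m"
    unfolding additive_def
  proof safe
    fix A B assume AB: "A \<in> sets S" "B \<in> sets S" "A \<inter> B = {}"
    have "indicator (A \<union> B) = (\<lambda>x. 1 * indicator A x + 1 * indicator B x :: real)"
      using AB(3) by (auto simp: indicator_def fun_eq_iff)
    then show "?m (A \<union> B) = ?m A + ?m B"
      using limit_lincomb[OF dominated_indicator[OF AB(1)] dominated_indicator[OF AB(2)], of 1 1]
        limit_nonneg[OF dominated_indicator[OF AB(1)]] limit_nonneg[OF dominated_indicator[OF AB(2)]]
      by (simp add: ennreal_plus[symmetric] del: ennreal_plus)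
  qed
  have "countably_additive (sets S) ?m"
  proof (rule sets.empty_continuous_imp_countably_additive[OF pos add])
    fix A :: "nat \<Rightarrow> 'a set" assume A: "range A \<subseteq> sets S" "decseq A" "(\<Inter>i. A i) = {}"
    have "(\<lambda>i. limit (indicator (A i))) \<longlonglongrightarrow> limit (\<lambda>_. 0)"
    proof (rule limit_dominated_convergence[where c = 1])
      show "dominated 1 (\<lambda>_. 0)" using V_nonneg by (simp add: dominated_def)
      fix x show "(\<lambda>i. indicator (A i) x :: real) \<longlonglongrightarrow> 0"
        using LIMSEQ_indicator_decseq[OF A(2)] A(3) by simp
    qed (use A in \<open>auto intro!: dominated_indicator\<close>)
    then show "(\<lambda>i. ?m (A i)) \<longlonglongrightarrow> 0" 
      using tendsto_ennrealI[of "\<lambda>i. limit (indicator (A i))" 0 sequentially] by (simp add: limit_const)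
  qed simp
  with pos show ?thesis
    unfolding stationary_def using A by (intro emeasure_measure_of_sigma) (auto simp: sets.sigma_algebra_axioms)
qed

lemma prob_stationary: "prob_space stationary"
proof
  have "limit (indicator (space S)) = limit (\<lambda>_. 1)"
  proof (rule limit_eqI[OF dominated_indicator])
    fix x assume x: "x \<in> space S"
    have "(transition ^^ n) (indicator (space S)) x = (transition ^^ n) (\<lambda>_. 1) x" for n
      using x
    proof (induction n arbitrary: x)
      case (Suc n)
      then show ?case by (auto simp: transition_def[of _ x] space_K intro!: Bochner_Integration.integral_cong)
    qed simp
    then show "(\<lambda>n. (transition ^^ n) (indicator (space S)) x) \<longlonglongrightarrow> limit (\<lambda>_. 1)"
      using iterate_tendsto_limit(1)[OF dominated_const[of 1] x] by simp
  qed simp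
  then show "emeasure stationary (space stationary) = 1"
    by (simp add: emeasure_stationary limit_const)
qed

lemma stationary_integral_nonneg:
  assumes "\<phi> \<in> borel_measurable S" "\<And>x. 0 \<le> \<phi> x" "dominated c \<phi>"
  shows "integrable stationary \<phi> \<and> (\<integral>x. \<phi> x \<partial>stationary) = limit \<phi>"
  using assms
proof (induction arbitrary: c rule: borel_measurable_induct_real)
  interpret prob_space stationary by (rule prob_stationary)
  {
    case (set A)
    then show ?case
      using limit_nonneg[OF dominated_indicator]
      by (simp add: measure_def emeasure_stationary integrable_real_indicator less_top[symmetric])
  next
    case (mult u a)
    show ?case
    proof (cases "a = 0")
      case False
      with mult(1) have "0 < a" by simp
      then have u: "dominated (c / a) u"
        using mult(2,5) by (auto simp: dominated_def abs_mult field_simps)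
      from mult(4)[OF this] limit_lincomb[OF u u, of a 0] show ?thesis by simp
    qed (simp add: limit_const)
  next
    case (add u v)
    have "\<bar>u x\<bar> \<le> c * (1 + V x) \<and> \<bar>v x\<bar> \<le> c * (1 + V x)" if "x \<in> space S" for x
      using dominatedD(2)[OF add.prems that] add.hyps(2,4)[of x] by linarith
    then have "dominated c u" "dominated c v"
      using add.hyps(1,3) by (auto simp: dominated_def)
    from add.IH(1)[OF this(1)] add.IH(2)[OF this(2)] limit_lincomb[OF this(2,1), of 1 1] show ?case
      by simp
  next
    case (seq U)
    have le: "U i x \<le> \<phi> x" if "x \<in> space S" for i x
      using incseq_le[of "\<lambda>i. U i x" "\<phi> x" i] seq.hyps(3,4) that by (simp add: incseq_def le_fun_def)
    have "\<bar>U i x\<bar> \<le> c * (1 + V x)" if "x \<in> space S" for i x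
      using dominatedD(2)[OF seq.prems that] seq.hyps(2)[of i x] le[OF that, of i] by linarith
    then have U: "dominated c (U i)" for i
      using seq.hyps(1) by (auto simp: dominated_def)
    have lim: "(\<lambda>i. limit (U i)) \<longlonglongrightarrow> limit \<phi>"
      by (rule limit_dominated_convergence[OF U seq.prems seq.hyps(4)])
    have IH: "integrable stationary (U i)" "(\<integral>x. U i x \<partial>stationary) = limit (U i)" for i
      using seq.IH[OF U] by auto
    have *: "AE x in stationary. mono (\<lambda>i. U i x)" "AE x in stationary. (\<lambda>i. U i x) \<longlonglongrightarrow> \<phi> x"
      using seq.hyps(3,4) by (auto simp: incseq_def le_fun_def)
    have **: "\<phi> \<in> borel_measurable stationary"
      using dominatedD(1)[OF seq.prems] by (simp add: measurable_cong_sets[OF sets_stationary refl])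
    have ilim: "(\<lambda>i. \<integral>x. U i x \<partial>stationary) \<longlonglongrightarrow> limit \<phi>"
      using lim by (simp add: IH(2))
    show ?case
      using integrable_monotone_convergence[OF IH(1) * ilim **]
        integral_monotone_convergence[OF IH(1) * ilim **] by blast
  }
qed

lemma stationary_integral:
  assumes d: "dominated c \<phi>"
  shows "integrable stationary \<phi>" "(\<integral>x. \<phi> x \<partial>stationary) = limit \<phi>"
proof -
  have p: "dominated c (\<lambda>x. max 0 (\<phi> x))" "dominated c (\<lambda>x. max 0 (- \<phi> x))"
    using d dominated_nonneg[OF d] V_nonneg by (auto simp: dominated_def abs_if split: if_splits)
  have *: "integrable stationary (\<lambda>x. max 0 (\<phi> x)) \<and> (\<integral>x. max 0 (\<phi> x) \<partial>stationary) = limit (\<lambda>x. max 0 (\<phi> x))"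
    "integrable stationary (\<lambda>x. max 0 (- \<phi> x)) \<and> (\<integral>x. max 0 (- \<phi> x) \<partial>stationary) = limit (\<lambda>x. max 0 (- \<phi> x))"
    using stationary_integral_nonneg[OF dominatedD(1)[OF p(1)] _ p(1)]
      stationary_integral_nonneg[OF dominatedD(1)[OF p(2)] _ p(2)] by auto
  have eq: "\<phi> = (\<lambda>x. 1 * max 0 (\<phi> x) + (-1) * max 0 (- \<phi> x))" by (auto simp: fun_eq_iff)
  show "integrable stationary \<phi>"
    by (subst eq) (use * in \<open>intro Bochner_Integration.integrable_add integrable_mult_right; blast\<close>)
  show "(\<integral>x. \<phi> x \<partial>stationary) = limit \<phi>"
    using * by (subst (1 2) eq, subst limit_lincomb[OF p]) simp
qed

definition invariant :: "'a measure \<Rightarrow> bool" where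
  "invariant \<mu> \<longleftrightarrow> prob_space \<mu> \<and> sets \<mu> = sets S \<and>
    (\<forall>A\<in>sets S. emeasure \<mu> A = (\<integral>\<^sup>+x. emeasure (K x) A \<partial>\<mu>))"

lemma emeasure_K: "x \<in> space S \<Longrightarrow> A \<in> sets S \<Longrightarrow> emeasure (K x) A = ennreal (transition (indicator A) x)"
  using prob_space.finite_measure[OF prob_K[of x]]
  by (simp add: transition_def finite_measure.emeasure_eq_measure sets_K)

lemma invariant_stationary: "invariant stationary"
  unfolding invariant_def
proof safe
  fix A assume A: "A \<in> sets S"
  note d = dominated_indicator[OF A]
  have "(\<integral>\<^sup>+x. emeasure (K x) A \<partial>stationary) = (\<integral>\<^sup>+x. ennreal (transition (indicator A) x) \<partial>stationary)"
    by (intro nn_integral_cong) (simp add: emeasure_K A)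
  also have "\<dots> = ennreal (limit (transition (indicator A)))"
    using iterate_nonneg[of "indicator A" _ 1]
    by (subst nn_integral_eq_integral) (auto simp: stationary_integral[OF transition_dominated[OF d]])
  also have "\<dots> = emeasure stationary A"
    using A by (simp add: limit_transition[OF d] emeasure_stationary)
  finally show "emeasure stationary A = (\<integral>\<^sup>+x. emeasure (K x) A \<partial>stationary)" ..
qed (auto simp: prob_stationary)

lemma invariant_bind:
  assumes inv: "invariant \<mu>" shows "\<mu> = \<mu> \<bind> K"
proof (rule measure_eqI)
  have sets: "sets \<mu> = sets S" and "prob_space \<mu>" using inv by (auto simp: invariant_def)
  have ne: "space \<mu> \<noteq> {}" using space_not_empty sets_eq_imp_space_eq[OF sets] by simp
  have K: "K \<in> \<mu> \<rightarrow>\<^sub>M subprob_algebra S"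
    using measurable_prob_algebraD[OF kernel] by (simp add: measurable_cong_sets[OF sets refl])
  show "sets \<mu> = sets (\<mu> \<bind> K)" using sets_bind[of \<mu> K S] ne sets sets_K sets_eq_imp_space_eq[OF sets] by auto
  fix A assume "A \<in> sets \<mu>"
  then show "emeasure \<mu> A = emeasure (\<mu> \<bind> K) A"
    using inv emeasure_bind[OF ne K, of A] by (simp add: sets invariant_def)
qed

text \<open>
  An invariant measure may a priori fail to integrate \<open>V\<close>, so the argument runs over indicators, for
  which bounded convergence is available: \<open>\<mu> A\<close> is the \<open>\<mu>\<close>-integral of every iterate of the indicator of
  \<open>A\<close>, and these iterates tend to the mass that \<open>stationary\<close> gives to \<open>A\<close>.
\<close>

lemma invariant_unique:
  assumes inv: "invariant \<mu>" shows "\<mu> = stationary"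
proof (rule measure_eqI)
  interpret prob_space \<mu> using inv by (simp add: invariant_def)
  have sets: "sets \<mu> = sets S" using inv by (simp add: invariant_def)
  note [simp] = sets_eq_imp_space_eq[OF sets]
  show "sets \<mu> = sets stationary" by (simp add: sets)
  have K: "K \<in> \<mu> \<rightarrow>\<^sub>M subprob_algebra S"
    using measurable_prob_algebraD[OF kernel] by (simp add: measurable_cong_sets[OF sets refl])
  fix A assume "A \<in> sets \<mu>"
  then have A: "A \<in> sets S" by (simp add: sets)
  note d = dominated_indicator[OF A]
  define f where "f n = (transition ^^ n) (indicator A)" for n
  have fm [measurable]: "f n \<in> borel_measurable S" for n
    unfolding f_def using iterate_dominated[OF d] by (rule dominatedD(1))
  have f01: "0 \<le> f n x \<and> f n x \<le> 1" if "x \<in> space S" for n x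
    using that
  proof (induction n arbitrary: x)
    case (Suc n)
    interpret Kx: prob_space "K x" using Suc.prems by (rule prob_K)
    have "integrable (K x) (f n)" 
      unfolding f_def using integrable_dominated[OF iterate_dominated[OF d] Suc.prems] .
    then have "0 \<le> (\<integral>y. f n y \<partial>K x)" "(\<integral>y. f n y \<partial>K x) \<le> 1"
      using Suc by (auto intro!: integral_nonneg_AE AE_I2 Kx.integral_le_const simp: space_K)
    then show ?case by (simp add: f_def transition_def)
  qed (simp add: f_def)
  have fm\<mu>: "f n \<in> borel_measurable \<mu>" for n using fm by (simp add: measurable_cong_sets[OF sets refl])
  have int: "integrable \<mu> (f n)" for n
    using f01 by (intro integrable_const_bound[where B = 1]) (auto simp: fm\<mu>)
  have const: "(\<integral>x. f n x \<partial>\<mu>) = measure \<mu> A" for n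
  proof (induction n)
    case 0
    then show ?case using A by (simp add: f_def sets)
  next
    case (Suc n)
    have "(\<integral>x. f n x \<partial>\<mu>) = (\<integral>x. f n x \<partial>(\<mu> \<bind> K))" using invariant_bind[OF inv] by simp
    also have "\<dots> = (\<integral>x. \<integral>y. f n y \<partial>K x \<partial>\<mu>)"
      using f01 prob_space.emeasure_space_1[OF prob_K]
      by (intro integral_bind[where K = S and B = 1 and B' = 1] fm K) (auto intro!: AE_I2)
    finally show ?case using Suc by (simp add: f_def transition_def[abs_def])
  qed
  have "(\<lambda>n. \<integral>x. f n x \<partial>\<mu>) \<longlonglongrightarrow> (\<integral>x. limit (indicator A) \<partial>\<mu>)"
    using f01 iterate_tendsto_limit(1)[OF d]
    by (intro integral_dominated_convergence[where w = "\<lambda>_. 1"]) (auto simp: fm\<mu>, auto simp: f_def)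
  then have "measure \<mu> A = limit (indicator A)"
    unfolding const using prob_space by (simp add: LIMSEQ_const_iff)
  then show "emeasure \<mu> A = emeasure stationary A"
    using A by (simp add: emeasure_stationary emeasure_eq_measure)
qed

theorem geometric_convergence:
  assumes "\<phi> \<in> borel_measurable S" "\<And>x. x \<in> space S \<Longrightarrow> \<bar>\<phi> x\<bar> \<le> 1 + V x"
  shows "integrable stationary \<phi>"
    and "x \<in> space S \<Longrightarrow>
      \<bar>(transition ^^ n) \<phi> x - (\<integral>y. \<phi> y \<partial>stationary)\<bar> \<le> bound_const * contraction_rate ^ n * (1 + V x)"
proof -
  have d: "dominated 1 \<phi>" using assms by (simp add: dominated_def)
  then show "integrable stationary \<phi>" by (rule stationary_integral)
  show "x \<in> space S \<Longrightarrow>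
      \<bar>(transition ^^ n) \<phi> x - (\<integral>y. \<phi> y \<partial>stationary)\<bar> \<le> bound_const * contraction_rate ^ n * (1 + V x)"
    using iterate_tendsto_limit(2)[OF d] by (simp add: stationary_integral(2)[OF d])
qed

end

section \<open>Moments of Gaussian vectors\<close>

text \<open>
  Lebesgue measure on a Euclidean space is the image of the product measure indexed by the basis; here
  the basis is reindexed by the coordinates.
\<close>

lemma lborel_integral_prod_coordinates:
  fixes f :: "'n::finite \<Rightarrow> real \<Rightarrow> real"
  assumes f: "\<And>i. integrable lborel (f i)"
  shows "has_bochner_integral lborel (\<lambda>x::real^'n. \<Prod>i\<in>UNIV. f i (x $ i)) (\<Prod>i\<in>UNIV. \<integral>t. f i t \<partial>lborel)"
proof -
  interpret product_sigma_finite "\<lambda>_::real^'n. lborel :: real measure" ..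
  define \<iota> where "\<iota> = inv (\<lambda>i::'n. axis i (1::real))"
  have inj: "inj (\<lambda>i::'n. axis i (1::real))"
    by (auto simp: inj_def axis_eq_axis)
  have \<iota>: "\<iota> (axis i 1) = i" for i
    unfolding \<iota>_def using inj by (rule inv_f_f)
  have Basis: "(Basis :: (real^'n) set) = range (\<lambda>i. axis i 1)"
    by (auto simp: Basis_vec_def)
  have reindex: "(\<Prod>b\<in>(Basis::(real^'n) set). g (\<iota> b) b) = (\<Prod>i\<in>UNIV. g i (axis i 1))" for g :: "'n \<Rightarrow> real^'n \<Rightarrow> real"
    unfolding Basis by (subst prod.reindex[OF inj]) (simp add: \<iota>)
  let ?P = "\<Pi>\<^sub>M b\<in>(Basis::(real^'n) set). (lborel::real measure)"
  have "has_bochner_integral ?P (\<lambda>h. \<Prod>b\<in>Basis. f (\<iota> b) (h b)) (\<Prod>b\<in>(Basis::(real^'n) set). \<integral>t. f (\<iota> b) t \<partial>lborel)"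
    using product_integrable_prod[of Basis "\<lambda>b. f (\<iota> b)"] product_integral_prod[of Basis "\<lambda>b. f (\<iota> b)"] f
    by (simp add: has_bochner_integral_iff)
  also have "(\<Prod>b\<in>(Basis::(real^'n) set). \<integral>t. f (\<iota> b) t \<partial>lborel) = (\<Prod>i\<in>UNIV. \<integral>t. f i t \<partial>lborel)"
    by (rule reindex)
  also have "(\<lambda>h. \<Prod>b\<in>Basis. f (\<iota> b) (h b)) = (\<lambda>h. \<Prod>i\<in>UNIV. f i ((\<Sum>b\<in>Basis. h b *\<^sub>R b) $ i))"
  proof
    fix h :: "real^'n \<Rightarrow> real"
    have "(\<Sum>b\<in>Basis. h b *\<^sub>R b) $ i = h (axis i 1)" for i
      using inner_sum_left_Basis[of "axis i 1" h] by (simp add: cart_eq_inner_axis)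
    then show "(\<Prod>b\<in>Basis. f (\<iota> b) (h b)) = (\<Prod>i\<in>UNIV. f i ((\<Sum>b\<in>Basis. h b *\<^sub>R b) $ i))"
      using reindex[of "\<lambda>i b. f i (h b)"] by simp
  qed
  finally have P: "has_bochner_integral ?P (\<lambda>h. \<Prod>i\<in>UNIV. f i ((\<Sum>b\<in>Basis. h b *\<^sub>R b) $ i)) (\<Prod>i\<in>UNIV. \<integral>t. f i t \<partial>lborel)" .
  have [measurable]: "f i \<in> borel_measurable borel" for i
    using borel_measurable_integrable[OF f[of i]] by simp
  show ?thesis
    unfolding lborel_eq[where 'a = "real^'n"]
  proof (rule has_bochner_integral_distr)
    show "has_bochner_integral ?P (\<lambda>h. \<Prod>i\<in>UNIV. f i ((\<Sum>b\<in>Basis. h b *\<^sub>R b) $ i)) (\<Prod>i\<in>UNIV. \<integral>t. f i t \<partial>lborel)"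
      by (rule P)
  qed measurable
qed

definition gaussian :: "real \<Rightarrow> (real^'n::finite) measure" where
  "gaussian s = density lborel (\<lambda>x. ennreal (\<Prod>i\<in>UNIV. normal_density 0 s (x $ i)))"

lemma sets_gaussian [simp]: "sets (gaussian s) = sets borel"
  and space_gaussian [simp]: "space (gaussian s) = UNIV"
  by (simp_all add: gaussian_def)

lemma gaussian_prod_coordinates:
  fixes f :: "'n::finite \<Rightarrow> real \<Rightarrow> real"
  assumes [measurable]: "\<And>i. f i \<in> borel_measurable borel"
    and f: "\<And>i. integrable lborel (\<lambda>t. normal_density 0 s t * f i t)"
  shows "has_bochner_integral (gaussian s) (\<lambda>x::real^'n. \<Prod>i\<in>UNIV. f i (x $ i))
    (\<Prod>i\<in>UNIV. \<integral>t. normal_density 0 s t * f i t \<partial>lborel)"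
  unfolding gaussian_def
  using lborel_integral_prod_coordinates[OF f]
  by (intro has_bochner_integral_density) (auto simp: prod.distrib prod_nonneg)

lemma gaussian_moments:
  assumes s: "0 < s"
  shows "has_bochner_integral (gaussian s) (\<lambda>_::real^'n::finite. 1::real) 1"
    and "has_bochner_integral (gaussian s) (\<lambda>x::real^'n. x $ j) 0"
    and "has_bochner_integral (gaussian s) (\<lambda>x::real^'n. x $ j * x $ k) (if j = k then s\<^sup>2 else 0)"
proof -
  note int = integrable_normal_moment[OF s, of 0, simplified]
  have m0: "(\<integral>t. normal_density 0 s t * 1 \<partial>lborel) = 1" "integrable lborel (\<lambda>t. normal_density 0 s t * 1)"
    using int[of 0] s by auto
  have m1: "(\<integral>t. normal_density 0 s t * t \<partial>lborel) = 0" "integrable lborel (\<lambda>t. normal_density 0 s t * t)"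
    using int[of 1] integral_normal_moment_odd[OF s, of 0 0] by auto
  have m2: "(\<integral>t. normal_density 0 s t * (t * t) \<partial>lborel) = s\<^sup>2" "integrable lborel (\<lambda>t. normal_density 0 s t * (t * t))"
    using int[of 2] integral_normal_moment_even[OF s, of 0 1] by (auto simp: power2_eq_square)
  show "has_bochner_integral (gaussian s) (\<lambda>_::real^'n. 1::real) 1"
    using gaussian_prod_coordinates[of "\<lambda>(i::'n) t. 1" s] m0 by simp
  show "has_bochner_integral (gaussian s) (\<lambda>x::real^'n. x $ j) 0"
  proof -
    let ?f = "\<lambda>(i::'n) t::real. if i = j then t else 1"
    have "(\<integral>t. normal_density 0 s t * ?f i t \<partial>lborel) = (if i = j then 0 else 1)" for i
      using m0 m1 by simp
    then have mean: "(\<Prod>i\<in>UNIV. \<integral>t. normal_density 0 s t * ?f i t \<partial>lborel) = 0"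
      by simp
    have coord: "(\<Prod>i\<in>UNIV. ?f i (x $ i)) = x $ j" for x :: "real^'n"
      by simp
    have "integrable lborel (\<lambda>t. normal_density 0 s t * ?f i t)" for i
      using m0 m1 by (cases "i = j") simp_all
    then have "has_bochner_integral (gaussian s) (\<lambda>x::real^'n. \<Prod>i\<in>UNIV. ?f i (x $ i))
        (\<Prod>i\<in>UNIV. \<integral>t. normal_density 0 s t * ?f i t \<partial>lborel)"
      by (intro gaussian_prod_coordinates) simp_all
    then show ?thesis unfolding mean coord .
  qed
  show "has_bochner_integral (gaussian s) (\<lambda>x::real^'n. x $ j * x $ k) (if j = k then s\<^sup>2 else 0)"
  proof -
    let ?f = "\<lambda>(i::'n) t::real. (if i = j then t else 1) * (if i = k then t else 1)"
    have I: "(\<integral>t. normal_density 0 s t * ?f i t \<partial>lborel) = (if i = j then if i = k then s\<^sup>2 else 0 else if i = k then 0 else 1)" for i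
      using m0 m1 m2 by simp
    have "(\<Prod>i\<in>UNIV. \<integral>t. normal_density 0 s t * ?f i t \<partial>lborel) = (if j = k then s\<^sup>2 else 0)"
    proof (cases "j = k")
      case True
      then have "(if i = j then if i = k then s\<^sup>2 else 0 else if i = k then 0 else 1) = (if i = k then s\<^sup>2 else 1)" for i
        by simp
      with True show ?thesis unfolding I by simp
    next
      case False
      then have "\<exists>i\<in>UNIV. (if i = j then if i = k then s\<^sup>2 else 0 else if i = k then 0 else 1) = 0" by auto
      then show ?thesis using False unfolding I by simp
    qed
    note moment = this
    have coord: "(\<Prod>i\<in>UNIV. ?f i (x $ i)) = x $ j * x $ k" for x :: "real^'n"
      by (simp add: prod.distrib)
    have "integrable lborel (\<lambda>t. normal_density 0 s t * ?f i t)" for i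
      using m0 m1 m2 by (cases "i = j"; cases "i = k") simp_all
    then have "has_bochner_integral (gaussian s) (\<lambda>x::real^'n. \<Prod>i\<in>UNIV. ?f i (x $ i))
        (\<Prod>i\<in>UNIV. \<integral>t. normal_density 0 s t * ?f i t \<partial>lborel)"
      by (intro gaussian_prod_coordinates) simp_all
    then show ?thesis unfolding moment coord .
  qed
qed

lemma norm_power2_vec: "(norm (x::real^'n::finite))\<^sup>2 = (\<Sum>i\<in>UNIV. (x $ i)\<^sup>2)"
  by (simp add: norm_vec_def L2_set_def sum_nonneg)

lemma gaussian_second_moment:
  fixes a :: "real^'d::finite" and A :: "real^'m::finite^'d"
  assumes s: "0 < s"
  shows "has_bochner_integral (gaussian s) (\<lambda>z. (norm (a + A *v z))\<^sup>2) ((norm a)\<^sup>2 + s\<^sup>2 * (norm A)\<^sup>2)"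
proof -
  let ?G = "gaussian s :: (real^'m) measure"
  have expand: "(norm (a + A *v z))\<^sup>2 = (\<Sum>i\<in>UNIV. (a $ i)\<^sup>2 * 1 + 2 * a $ i * (\<Sum>j\<in>UNIV. A $ i $ j * z $ j)
      + (\<Sum>j\<in>UNIV. \<Sum>k\<in>UNIV. A $ i $ j * A $ i $ k * (z $ j * z $ k)))" for z
    unfolding norm_power2_vec
    by (intro sum.cong refl)
       (simp add: matrix_vector_mult_def power2_sum power2_eq_square sum_product algebra_simps sum_distrib_left)
  have "has_bochner_integral ?G (\<lambda>z. (norm (a + A *v z))\<^sup>2)
    (\<Sum>i\<in>UNIV. (a $ i)\<^sup>2 * 1 + 2 * a $ i * (\<Sum>j\<in>UNIV. A $ i $ j * 0)
      + (\<Sum>j\<in>UNIV. \<Sum>k\<in>UNIV. A $ i $ j * A $ i $ k * (if j = k then s\<^sup>2 else 0)))"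
    unfolding expand
    by (intro has_bochner_integral_sum has_bochner_integral_add has_bochner_integral_mult_right gaussian_moments[OF s])
  also have "(\<Sum>i\<in>UNIV. (a $ i)\<^sup>2 * 1 + 2 * a $ i * (\<Sum>j\<in>UNIV. A $ i $ j * 0)
      + (\<Sum>j\<in>UNIV. \<Sum>k\<in>UNIV. A $ i $ j * A $ i $ k * (if j = k then s\<^sup>2 else 0))) = (norm a)\<^sup>2 + s\<^sup>2 * (norm A)\<^sup>2"
    by (simp add: norm_vec_def L2_set_def sum_nonneg sum.distrib sum_distrib_left if_distrib power2_eq_square
         algebra_simps cong: if_cong)
  finally show ?thesis .
qed

lemma prob_space_gaussian: "0 < s \<Longrightarrow> prob_space (gaussian s :: (real^'n::finite) measure)"
proof
  assume "0 < s"
  note m = gaussian_moments(1)[OF this, where 'n = 'n]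
  have "emeasure (gaussian s :: (real^'n) measure) UNIV = (\<integral>\<^sup>+x. ennreal 1 \<partial>(gaussian s :: (real^'n) measure))"
    by simp
  also have "\<dots> = ennreal 1"
    using m by (subst nn_integral_eq_integral) (auto simp: has_bochner_integral_iff)
  finally show "emeasure (gaussian s :: (real^'n) measure) (space (gaussian s)) = 1" by simp
qed

section \<open>Minorization of non-degenerate Gaussian kernels\<close>

text \<open>
  The right inverse is \<open>A\<^sup>T (A A\<^sup>T)\<^sup>-\<^sup>1\<close>. With \<open>w = (A A\<^sup>T)\<^sup>-\<^sup>1 u\<close> one has \<open>|A\<^sup>T w|\<^sup>2 = \<langle>w, u\<rangle>\<close>, so the lower bound on
  \<open>A\<^sup>T\<close> gives first \<open>|w| \<le> |u| / l\<close> and then \<open>|A\<^sup>T w|\<^sup>2 \<le> |u|\<^sup>2 / l\<close>.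
\<close>

lemma bounded_right_inverse:
  fixes A :: "real^'m::finite^'d::finite"
  assumes l: "0 < l" and A: "\<And>v. l * (norm v)\<^sup>2 \<le> (norm (transpose A *v v))\<^sup>2"
  obtains P :: "real^'d^'m" where "\<And>u. A *v (P *v u) = u" "\<And>u. norm (P *v u) \<le> norm u / sqrt l"
proof -
  let ?M = "A ** transpose A"
  have M: "v \<bullet> (?M *v v) = (norm (transpose A *v v))\<^sup>2" for v
    by (simp add: matrix_vector_mul_assoc[symmetric] dot_lmul_matrix[symmetric] power2_norm_eq_inner
        matrix_vector_mul_lid transpose_matrix_vector vector_transpose_matrix)
  have "inj ((*v) ?M)"
  proof (subst linear_injective_0)
    show "\<forall>v. ?M *v v = 0 \<longrightarrow> v = 0"
    proof safe
      fix v assume "?M *v v = 0"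
      with M[of v] A[of v] have "l * (norm v)\<^sup>2 \<le> 0" by simp
      with l show "v = 0" by (simp add: mult_le_0_iff)
    qed
  qed simp
  then obtain N where "N ** ?M = mat 1" using matrix_left_invertible_injective[of ?M] by blast
  then have N: "?M ** N = mat 1" using matrix_left_right_inverse by blast
  have MN: "?M *v (N *v u) = u" for u by (simp add: matrix_vector_mul_assoc N)
  show thesis
  proof
    show "A *v ((transpose A ** N) *v u) = u" for u
      using MN[of u] by (simp add: matrix_vector_mul_assoc matrix_mul_assoc)
    fix u
    define w where "w = N *v u"
    have eq: "(norm (transpose A *v w))\<^sup>2 = w \<bullet> u"
      using M[of w] MN[of u] by (simp add: w_def)
    have wu: "w \<bullet> u \<le> norm w * norm u" by (rule norm_cauchy_schwarz)
    have "l * (norm w)\<^sup>2 \<le> norm w * norm u" using A[of w] eq wu by linarith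
    then have "norm w * (l * norm w) \<le> norm w * norm u" by (simp add: power2_eq_square algebra_simps)
    then have "l * norm w \<le> norm u" by (cases "norm w = 0") auto
    then have "norm w \<le> norm u / l" using l by (simp add: field_simps)
    then have "norm w * norm u \<le> norm u / l * norm u" by (rule mult_right_mono) simp
    then have "(norm (transpose A *v w))\<^sup>2 \<le> (norm u / sqrt l)\<^sup>2"
      using eq wu l by (simp add: power_divide power2_eq_square)
    then have "norm (transpose A *v w) \<le> norm u / sqrt l" 
      by (rule power2_le_imp_le) (use l in simp)
    then show "norm ((transpose A ** N) *v u) \<le> norm u / sqrt l"
      by (simp add: w_def matrix_vector_mul_assoc)
  qed
qed

lemma nn_integral_lborel_translate:
  fixes c :: "'a::euclidean_space"
  assumes f: "f \<in> borel_measurable borel"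
  shows "(\<integral>\<^sup>+x. f (c + x) \<partial>lborel) = (\<integral>\<^sup>+x. f x \<partial>lborel)"
proof -
  have "(\<integral>\<^sup>+x. f x \<partial>lborel) = (\<integral>\<^sup>+x. f x \<partial>distr lborel borel ((+) c))"
    by (simp only: lborel_distr_plus)
  also have "\<dots> = (\<integral>\<^sup>+x. f (c + x) \<partial>lborel)"
    using f by (subst nn_integral_distr) auto
  finally show ?thesis ..
qed

text \<open>
  The law of \<open>a + A z\<close> need not be computed. Translating \<open>z\<close> by \<open>P u\<close> translates the image by \<open>u\<close>, so for
  every \<open>u\<close> the mass of \<open>B\<close> is the integral of \<open>g (z + P u)\<close> over the \<open>z\<close> with \<open>a + A z + u \<in> B\<close>. Integrating
  this identity over \<open>u\<close> in a ball and exchanging the integrals turns \<open>v = a + A z + u\<close> into a variable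
  distributed by Lebesgue measure on \<open>\<real>\<^sup>d\<close>, and \<open>g\<close> is bounded below by \<open>\<delta>\<close> on the relevant set. Resting on
  translation invariance alone, the argument allows \<open>A\<close> to map between spaces of different dimension.
\<close>

lemma affine_image_lower_bound:
  fixes g :: "real^'m::finite \<Rightarrow> real" and A :: "real^'m^'d::finite" and P :: "real^'d^'m"
  assumes g [measurable]: "g \<in> borel_measurable borel"
    and AP: "\<And>u. A *v (P *v u) = u"
    and r: "\<And>v z. v \<in> ball 0 1 \<Longrightarrow> z \<in> ball 0 1 \<Longrightarrow> norm (v - a - A *v z) < r"
    and \<delta>: "\<And>v z. v \<in> ball 0 1 \<Longrightarrow> z \<in> ball 0 1 \<Longrightarrow> \<delta> \<le> g (z + P *v (v - a - A *v z))"
    and B [measurable]: "B \<in> sets borel"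
  shows "ennreal \<delta> * emeasure lborel (ball (0::real^'m) 1) * emeasure lborel (B \<inter> ball 0 1)
    \<le> emeasure lborel (ball (0::real^'d) r) * emeasure (distr (density lborel (\<lambda>z. ennreal (g z))) borel (\<lambda>z. a + A *v z)) B"
proof -
  have [measurable]: "(\<lambda>z. A *v z) \<in> borel_measurable borel" "(\<lambda>z. P *v z) \<in> borel_measurable borel"
    by (intro borel_measurable_continuous_onI linear_continuous_on matrix_vector_mul_bounded_linear)+
  have [measurable]: "ball (0::real^'d) r \<in> sets borel" by simp
  let ?Q = "emeasure (distr (density lborel (\<lambda>z. ennreal (g z))) borel (\<lambda>z. a + A *v z)) B"
  have Q: "?Q = (\<integral>\<^sup>+z. ennreal (g (z + P *v u)) * indicator B (a + A *v z + u) \<partial>lborel)" for u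
  proof -
    have "?Q = (\<integral>\<^sup>+z. ennreal (g z) * indicator B (a + A *v z) \<partial>lborel)"
    proof -
      have "(\<lambda>z. a + A *v z) -` B \<inter> space lborel \<in> sets lborel"
        by (rule measurable_sets[OF _ B]) measurable
      then have "?Q = (\<integral>\<^sup>+z. ennreal (g z) * indicator ((\<lambda>z. a + A *v z) -` B) z \<partial>lborel)"
        by (simp add: emeasure_distr emeasure_density)
      then show ?thesis by (simp add: indicator_def)
    qed
    also have "\<dots> = (\<integral>\<^sup>+z. ennreal (g (P *v u + z)) * indicator B (a + A *v (P *v u + z)) \<partial>lborel)"
      by (rule nn_integral_lborel_translate[symmetric]) measurable
    finally show ?thesis by (simp add: matrix_vector_right_distrib AP algebra_simps)
  qed
  have "emeasure lborel (ball (0::real^'d) r) * ?Q = (\<integral>\<^sup>+u. ?Q * indicator (ball (0::real^'d) r) u \<partial>lborel)"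
    by (subst nn_integral_cmult_indicator) (auto simp: mult.commute)
  also have "\<dots> = (\<integral>\<^sup>+u. \<integral>\<^sup>+z. ennreal (g (z + P *v u)) * indicator B (a + A *v z + u) * indicator (ball (0::real^'d) r) u \<partial>lborel \<partial>lborel)"
  proof (rule nn_integral_cong)
    fix u :: "real^'d"
    show "?Q * indicator (ball 0 r) u = (\<integral>\<^sup>+z. ennreal (g (z + P *v u)) * indicator B (a + A *v z + u) * indicator (ball 0 r) u \<partial>lborel)"
      unfolding Q[of u] by (rule nn_integral_multc[symmetric]) measurable
  qed
  also have "\<dots> = (\<integral>\<^sup>+z. \<integral>\<^sup>+u. ennreal (g (z + P *v u)) * indicator B (a + A *v z + u) * indicator (ball (0::real^'d) r) u \<partial>lborel \<partial>lborel)"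
    by (rule lborel_pair.Fubini') measurable
  also have "\<dots> = (\<integral>\<^sup>+z. \<integral>\<^sup>+v. ennreal (g (z + P *v (v - a - A *v z))) * indicator B v * indicator (ball (0::real^'d) r) (v - a - A *v z) \<partial>lborel \<partial>lborel)"
  proof (rule nn_integral_cong)
    fix z :: "real^'m"
    let ?f = "\<lambda>u. ennreal (g (z + P *v u)) * indicator B (a + A *v z + u) * indicator (ball (0::real^'d) r) u"
    have "(\<integral>\<^sup>+u. ?f u \<partial>lborel) = (\<integral>\<^sup>+v. ?f ((- a - A *v z) + v) \<partial>lborel)"
      by (rule nn_integral_lborel_translate[symmetric]) measurable
    then show "(\<integral>\<^sup>+u. ?f u \<partial>lborel) = (\<integral>\<^sup>+v. ennreal (g (z + P *v (v - a - A *v z))) * indicator B v * indicator (ball (0::real^'d) r) (v - a - A *v z) \<partial>lborel)"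
      by (simp add: algebra_simps)
  qed
  finally have avg: "emeasure lborel (ball (0::real^'d) r) * ?Q = (\<integral>\<^sup>+z. \<integral>\<^sup>+v. ennreal (g (z + P *v (v - a - A *v z))) * indicator B v * indicator (ball (0::real^'d) r) (v - a - A *v z) \<partial>lborel \<partial>lborel)" .
  have "ennreal \<delta> * emeasure lborel (ball (0::real^'m) 1) * emeasure lborel (B \<inter> ball 0 1)
    = (\<integral>\<^sup>+z. ennreal \<delta> * indicator (ball (0::real^'m) 1) z \<partial>lborel) * emeasure lborel (B \<inter> ball 0 1)"
    by (subst nn_integral_cmult_indicator) auto
  also have "\<dots> = (\<integral>\<^sup>+z. ennreal \<delta> * indicator (ball (0::real^'m) 1) z * emeasure lborel (B \<inter> ball 0 1) \<partial>lborel)"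
    by (rule nn_integral_multc[symmetric])
       (auto intro!: borel_measurable_times_ennreal borel_measurable_indicator)
  also have "\<dots> = (\<integral>\<^sup>+z. \<integral>\<^sup>+v. ennreal \<delta> * indicator (ball (0::real^'m) 1) z * indicator (B \<inter> ball 0 1) v \<partial>lborel \<partial>lborel)"
    by (intro nn_integral_cong nn_integral_cmult_indicator[symmetric]) (use B in auto)
  also have "\<dots> \<le> emeasure lborel (ball (0::real^'d) r) * ?Q"
    unfolding avg
  proof (intro nn_integral_mono)
    fix z :: "real^'m" and v :: "real^'d"
    show "ennreal \<delta> * indicator (ball 0 1) z * indicator (B \<inter> ball 0 1) v
      \<le> ennreal (g (z + P *v (v - a - A *v z))) * indicator B v * indicator (ball (0::real^'d) r) (v - a - A *v z)"
      using r[of v z] \<delta>[of v z] by (auto simp: indicator_def intro: ennreal_leI)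
  qed
  finally show ?thesis .
qed

lemma continuous_on_matrix_vector_mult:
  fixes f :: "'a::topological_space \<Rightarrow> real^'m::finite^'d::finite"
  assumes "continuous_on S f" "continuous_on S g"
  shows "continuous_on S (\<lambda>x. f x *v g x)"
  unfolding matrix_vector_mult_def using assms by (intro continuous_intros)

lemma continuous_on_transpose_mult:
  fixes f :: "'a::topological_space \<Rightarrow> real^'m::finite^'d::finite"
  assumes "continuous_on S f" "continuous_on S g"
  shows "continuous_on S (\<lambda>x. transpose (f x) *v g x)"
  unfolding matrix_vector_mult_def transpose_def using assms by (simp, intro continuous_intros)

lemma gaussian_density_lower_bound:
  assumes s: "0 < s"
  obtains \<delta> where "0 < \<delta>" "\<And>y::real^'n::finite. norm y \<le> \<rho> \<Longrightarrow> \<delta> \<le> (\<Prod>i\<in>UNIV. normal_density 0 s (y $ i))"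
proof (cases "0 \<le> \<rho>")
  case True
  let ?g = "\<lambda>y::real^'n. \<Prod>i\<in>UNIV. normal_density 0 s (y $ i)"
  have "continuous_on (cball 0 \<rho>) ?g"
    unfolding normal_density_def by (intro continuous_intros) (use s in auto)
  then obtain y where "y \<in> cball 0 \<rho>" "\<And>z. z \<in> cball 0 \<rho> \<Longrightarrow> ?g y \<le> ?g z"
    using continuous_attains_inf[of "cball (0::real^'n) \<rho>" ?g] True by auto
  moreover have "0 < ?g y"
    using normal_density_pos[OF s] by (intro prod_pos) auto
  ultimately show thesis using that[of "?g y"] by auto
next
  case False
  have "\<not> norm y \<le> \<rho>" for y :: "real^'n" using False norm_ge_zero[of y] by linarith
  then show thesis using that[of 1] by auto
qed

text \<open>
  On a bounded set of starting points all constants of \<open>affine_image_lower_bound\<close> can be chosen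
  uniformly by compactness. The minorizing measure is a multiple of Lebesgue measure on the unit ball.
\<close>

lemma gaussian_kernel_minorization:
  fixes a :: "real^'d::finite \<Rightarrow> real^'d" and A :: "real^'d \<Rightarrow> real^'m::finite^'d"
  assumes a: "continuous_on UNIV a" and A: "continuous_on UNIV A"
    and nondeg: "\<And>x v. v \<noteq> 0 \<Longrightarrow> transpose (A x) *v v \<noteq> 0" and s: "0 < s" and \<rho>: "0 \<le> \<rho>"
  obtains \<nu> :: "(real^'d) measure" where "sets \<nu> = sets borel" "finite_measure \<nu>" "0 < measure \<nu> (space \<nu>)"
    "\<And>x B. norm x \<le> \<rho> \<Longrightarrow> B \<in> sets borel \<Longrightarrow>
      emeasure \<nu> B \<le> emeasure (distr (gaussian s) borel (\<lambda>z. a x + A x *v z)) B"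
proof -
  let ?C = "cball (0::real^'d) \<rho>"
  let ?h = "\<lambda>p. (norm (transpose (A (fst p)) *v snd p))\<^sup>2"
  note contA = continuous_on_compose2[OF A continuous_on_fst[OF continuous_on_id] subset_UNIV]
  have cont: "continuous_on (?C \<times> sphere 0 1) ?h"
    by (intro continuous_intros continuous_on_transpose_mult contA)
  have comp: "compact (?C \<times> sphere (0::real^'d) 1)" by (intro compact_Times) auto
  have ne: "?C \<times> sphere (0::real^'d) 1 \<noteq> {}" using \<rho> by auto
  obtain p where p: "p \<in> ?C \<times> sphere 0 1" "\<And>q. q \<in> ?C \<times> sphere 0 1 \<Longrightarrow> ?h p \<le> ?h q"
    using continuous_attains_inf[OF comp ne cont] by blast
  \<comment> \<open>uniform ellipticity constant on the ball: the minimum over unit vectors\<close>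
  define l where "l = ?h p"
  have "snd p \<noteq> 0" using p(1) by auto
  then have l: "0 < l" using nondeg by (simp add: l_def)
  have ell: "l * (norm v)\<^sup>2 \<le> (norm (transpose (A x) *v v))\<^sup>2" if x: "norm x \<le> \<rho>" for x v
  proof (cases "v = 0")
    case False
    define u where "u = v /\<^sub>R norm v"
    have u: "v = norm v *\<^sub>R u" "norm u = 1" using False by (auto simp: u_def)
    have "transpose (A x) *v v = norm v *\<^sub>R (transpose (A x) *v u)"
      by (subst u(1)) (rule matrix_vector_mult_scaleR)
    then have "(norm (transpose (A x) *v v))\<^sup>2 = (norm (transpose (A x) *v u))\<^sup>2 * (norm v)\<^sup>2"
      by (simp add: power_mult_distrib)
    moreover have "l \<le> (norm (transpose (A x) *v u))\<^sup>2"
      using p(2)[of "(x, u)"] x u(2) by (simp add: l_def)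
    ultimately show ?thesis by (simp add: mult_right_mono)
  qed simp
  obtain ca where ca: "\<And>x. x \<in> ?C \<Longrightarrow> norm (a x) \<le> ca"
    using compact_imp_bounded[OF compact_continuous_image[OF continuous_on_subset[OF a subset_UNIV] compact_cball]]
    by (metis bounded_iff imageI)
  have "bounded ((\<lambda>p. A (fst p) *v snd p) ` (?C \<times> cball (0::real^'m) 1))"
    by (intro compact_imp_bounded compact_continuous_image compact_Times compact_cball
        continuous_on_matrix_vector_mult contA continuous_intros)
  then obtain cA where "\<And>p. p \<in> ?C \<times> cball (0::real^'m) 1 \<Longrightarrow> norm (A (fst p) *v snd p) \<le> cA"
    by (metis (no_types, lifting) bounded_iff imageI)
  then have cA: "norm (A x *v z) \<le> cA" if "norm x \<le> \<rho>" "norm z \<le> 1" for x z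
    using that by force
  \<comment> \<open>large enough for \<open>v - a x - A x z\<close> to lie in the ball of radius \<open>r\<close> when \<open>v\<close> and \<open>z\<close> are in the unit balls\<close>
  define r where "r = 1 + ca + cA"
  have "0 \<le> ca" "0 \<le> cA"
    using ca[of 0] cA[of 0 0] \<rho> norm_ge_zero[of "a 0"] by (simp_all del: norm_ge_zero)
  then have r: "0 < r" by (simp add: r_def)
  obtain \<delta> where \<delta>: "0 < \<delta>" "\<And>y::real^'m. norm y \<le> 1 + r / sqrt l \<Longrightarrow> \<delta> \<le> (\<Prod>i\<in>UNIV. normal_density 0 s (y $ i))"
    using gaussian_density_lower_bound[OF s, where \<rho> = "1 + r / sqrt l"] by metis
  define m where "m = measure lborel (ball (0::real^'m) 1)"
  define mr where "mr = measure lborel (ball (0::real^'d) r)"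
  have m: "0 < m" "0 < mr" using r by (auto simp: m_def mr_def content_ball_pos)
  have em: "emeasure lborel (ball (0::real^'m) 1) = ennreal m" "emeasure lborel (ball (0::real^'d) r) = ennreal mr"
    unfolding m_def mr_def
    by (intro emeasure_eq_ennreal_measure less_imp_neq emeasure_lborel_ball_finite[unfolded infinity_ennreal_def])+
  define \<nu> where "\<nu> = density lborel (\<lambda>v::real^'d. ennreal (\<delta> * m / mr) * indicator (ball 0 1) v)"
  have \<nu>: "emeasure \<nu> B = ennreal (\<delta> * m / mr) * emeasure lborel (B \<inter> ball 0 1)" if "B \<in> sets borel" for B
  proof -
    have "emeasure \<nu> B = (\<integral>\<^sup>+v. ennreal (\<delta> * m / mr) * indicator (B \<inter> ball 0 1) v \<partial>lborel)"
      unfolding \<nu>_def using that by (subst emeasure_density) (auto simp: indicator_def intro!: nn_integral_cong)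
    also have "\<dots> = ennreal (\<delta> * m / mr) * emeasure lborel (B \<inter> ball 0 1)"
      using that by (intro nn_integral_cmult_indicator) auto
    finally show ?thesis .
  qed
  have sp: "space \<nu> = UNIV" "sets \<nu> = sets borel" by (auto simp: \<nu>_def)
  have total: "emeasure \<nu> UNIV = ennreal (\<delta> * m / mr * measure lborel (ball (0::real^'d) 1))"
  proof -
    have "emeasure lborel (ball (0::real^'d) 1) = ennreal (measure lborel (ball (0::real^'d) 1))"
      by (intro emeasure_eq_ennreal_measure less_imp_neq emeasure_lborel_ball_finite[unfolded infinity_ennreal_def])
    then show ?thesis using \<delta>(1) m by (simp add: \<nu> ennreal_mult[symmetric])
  qed
  show thesis
  proof
    show "sets \<nu> = sets borel" by (rule sp)
    show "finite_measure \<nu>" by standard (simp add: sp total)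
    show "0 < measure \<nu> (space \<nu>)"
      using \<delta>(1) m content_ball_pos[of 1 "0::real^'d"] by (simp add: sp measure_def[of \<nu>] total)
    fix x :: "real^'d" and B :: "(real^'d) set"
    assume x: "norm x \<le> \<rho>" and B: "B \<in> sets borel"
    obtain P :: "real^'d^'m" where P: "\<And>u. A x *v (P *v u) = u" "\<And>u. norm (P *v u) \<le> norm u / sqrt l"
      using bounded_right_inverse[OF l ell[OF x]] by blast
    let ?Q = "emeasure (distr (gaussian s) borel (\<lambda>z. a x + A x *v z)) B"
    have near: "norm (v - a x - A x *v z) < r" if "v \<in> ball 0 1" "z \<in> ball 0 1" for v z
    proof -
      have "norm (v - a x - A x *v z) \<le> norm v + norm (a x) + norm (A x *v z)"
        by (meson norm_triangle_ineq4 order_trans add_right_mono)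
      then show ?thesis using that ca[of x] cA[OF x, of z] x by (simp add: r_def)
    qed
    have "ennreal \<delta> * emeasure lborel (ball (0::real^'m) 1) * emeasure lborel (B \<inter> ball 0 1)
      \<le> emeasure lborel (ball (0::real^'d) r) * ?Q"
      unfolding gaussian_def
    proof (rule affine_image_lower_bound[OF _ P(1) near _ B])
      fix v :: "real^'d" and z :: "real^'m" assume vz: "v \<in> ball 0 1" "z \<in> ball 0 1"
      have "norm (z + P *v (v - a x - A x *v z)) \<le> norm z + norm (v - a x - A x *v z) / sqrt l"
        using P(2)[of "v - a x - A x *v z"] norm_triangle_ineq[of z "P *v (v - a x - A x *v z)"] by linarith
      also have "\<dots> \<le> 1 + r / sqrt l"
        using near[OF vz] vz l by (intro add_mono divide_right_mono) auto
      finally show "\<delta> \<le> (\<Prod>i\<in>UNIV. normal_density 0 s ((z + P *v (v - a x - A x *v z)) $ i))"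
        by (rule \<delta>(2))
    qed measurable
    then have "ennreal \<delta> * ennreal m * emeasure lborel (B \<inter> ball 0 1) \<le> ennreal mr * ?Q"
      unfolding em .
    then have "ennreal (1 / mr) * (ennreal \<delta> * ennreal m * emeasure lborel (B \<inter> ball 0 1)) \<le> ennreal (1 / mr) * (ennreal mr * ?Q)"
      by (rule mult_left_mono) simp
    then show "emeasure \<nu> B \<le> ?Q"
      using m \<delta>(1) by (simp add: \<nu>[OF B] mult.assoc[symmetric] ennreal_mult[symmetric])
  qed
qed

section \<open>The Euler--Maruyama chain\<close>

lemma nondegenerate_if_positive_definite:
  fixes A :: "real^'m::finite^'d::finite"
  assumes "positive_definite (A ** transpose A)" "v \<noteq> 0"
  shows "transpose A *v v \<noteq> 0"
proof
  assume "transpose A *v v = 0"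
  then have "(A ** transpose A) *v v = 0"
    by (simp add: matrix_vector_mul_assoc[symmetric])
  with assms show False by (auto simp: positive_definite_def)
qed

text \<open>
  A single step size together with the one-step moment bound for \<open>V(x) = |x|\<^sup>2\<close>, whose left-hand side is
  the second moment of the scheme after one step from \<open>x\<close>.
\<close>

locale euler_maruyama = wiener_process M F W
  for M :: "'w measure" and F :: "real \<Rightarrow> 'w measure" and W :: "real \<Rightarrow> 'w \<Rightarrow> real^'m" +
  fixes b :: "real^'d \<Rightarrow> real^'d" and \<sigma> :: "real^'d \<Rightarrow> real^'m^'d" and \<tau> \<gamma> C :: real
  assumes cont_b: "continuous_on UNIV b" and cont_\<sigma>: "continuous_on UNIV \<sigma>" and \<tau>: "0 < \<tau>"
    and positive_definite: "\<And>x. positive_definite (\<sigma> x ** transpose (\<sigma> x))"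
    and drift: "\<And>x. (norm (x + \<tau> *\<^sub>R b x))\<^sup>2 + \<tau> * (norm (\<sigma> x))\<^sup>2 \<le> \<gamma> * (norm x)\<^sup>2 + C"
    and \<gamma>: "0 \<le> \<gamma>" "\<gamma> < 1" and C: "0 < C"
begin

definition em_increment :: "nat \<Rightarrow> 'w \<Rightarrow> real^'m" where
  "em_increment n \<omega> = W (real (Suc n) * \<tau>) \<omega> - W (real n * \<tau>) \<omega>"

definition em_step :: "real^'d \<Rightarrow> real^'m \<Rightarrow> real^'d" where
  "em_step x z = x + \<tau> *\<^sub>R b x + \<sigma> x *v z"

abbreviation Z where "Z \<equiv> em_scheme b \<sigma> W \<tau>"

lemma em_scheme_Suc: "Z x (Suc n) \<omega> = em_step (Z x n \<omega>) (em_increment n \<omega>)"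
  by (simp add: em_step_def em_increment_def)

declare em_scheme.simps(2) [simp del]

lemma measurable_em_step: "(\<lambda>(x, z). em_step x z) \<in> borel \<Otimes>\<^sub>M borel \<rightarrow>\<^sub>M borel"
proof -
  have "continuous_on UNIV (\<lambda>p. em_step (fst p) (snd p))"
    unfolding em_step_def
    by (intro continuous_intros continuous_on_matrix_vector_mult continuous_on_compose2[OF cont_b]
        continuous_on_compose2[OF cont_\<sigma>]) auto
  then show ?thesis
    by (simp add: borel_prod borel_measurable_continuous_onI case_prod_beta')
qed

lemma measurable_em_step' [measurable (raw)]:
  "f \<in> borel_measurable N \<Longrightarrow> g \<in> borel_measurable N \<Longrightarrow> (\<lambda>\<omega>. em_step (f \<omega>) (g \<omega>)) \<in> borel_measurable N"
  using measurable_compose[OF measurable_Pair measurable_em_step, of f N g] by simp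

lemma W_measurable [measurable]: "0 \<le> t \<Longrightarrow> W t \<in> borel_measurable M"
  using measurable_from_subalg[OF subalgebra_F adapted] .

lemma em_increment_measurable [measurable]: "em_increment n \<in> borel_measurable M"
  unfolding em_increment_def[abs_def] using \<tau> by (intro borel_measurable_diff W_measurable) auto

lemma em_scheme_adapted: "Z x n \<in> borel_measurable (F (real n * \<tau>))"
proof (induction n)
  case 0
  then show ?case by simp
next
  case (Suc n)
  have le: "0 \<le> real n * \<tau>" "real n * \<tau> \<le> real (Suc n) * \<tau>" using \<tau> by (auto simp: mult_right_mono)
  note up = measurable_from_subalg[OF F_mono[OF le]]
  have [measurable]: "Z x n \<in> borel_measurable (F (real (Suc n) * \<tau>))" by (rule up[OF Suc])
  have "em_increment n \<in> borel_measurable (F (real (Suc n) * \<tau>))"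
    unfolding em_increment_def[abs_def]
    using adapted[of "real (Suc n) * \<tau>"] up[OF adapted[OF le(1)]] le by (intro borel_measurable_diff) auto
  then show ?case
    unfolding em_scheme_Suc[abs_def] by measurable
qed

lemma em_scheme_measurable [measurable]: "Z x n \<in> borel_measurable M"
  by (rule measurable_from_subalg[OF subalgebra_F em_scheme_adapted]) (use \<tau> in simp)

lemma distr_em_increment: "distr M borel (em_increment n) = gaussian (sqrt \<tau>)"
proof -
  have "distr M lborel (em_increment n)
    = density lborel (\<lambda>x. ennreal (\<Prod>i\<in>UNIV. normal_density 0 (sqrt (real (Suc n) * \<tau> - real n * \<tau>)) (x $ i)))"
    unfolding em_increment_def[abs_def]
    using gaussian_increments[of "real n * \<tau>" "real (Suc n) * \<tau>"] \<tau>
    by (simp add: distributed_def mult_less_cancel_right)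
  moreover have "real (Suc n) * \<tau> - real n * \<tau> = \<tau>" by (simp add: algebra_simps)
  moreover have "distr M lborel (em_increment n) = distr M borel (em_increment n)"
    by (rule distr_cong) auto
  ultimately show ?thesis by (simp add: gaussian_def)
qed

text \<open>
  The Markov property in the form in which it is needed: the state at time \<open>n \<tau>\<close> is measurable with
  respect to \<open>F (n \<tau>)\<close>, of which the next increment is independent.
\<close>

lemma distr_state_increment:
  "distr M borel (Z x n) \<Otimes>\<^sub>M gaussian (sqrt \<tau>) = distr M (borel \<Otimes>\<^sub>M borel) (\<lambda>\<omega>. (Z x n \<omega>, em_increment n \<omega>))"
proof (rule pair_measure_eqI)
  have le: "0 \<le> real n * \<tau>" "real n * \<tau> < real (Suc n) * \<tau>" using \<tau> by (auto simp: mult_strict_right_mono)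
  have sub: "space (F (real n * \<tau>)) = space M" using subalgebra_F[OF le(1)] by (simp add: subalgebra_def)
  note law = distr_em_increment[symmetric, of n]
  show "sigma_finite_measure (distr M borel (Z x n))"
    by (intro prob_space_imp_sigma_finite prob_space_distr) simp
  show "sigma_finite_measure (gaussian (sqrt \<tau>) :: (real^'m) measure)"
    unfolding law by (intro prob_space_imp_sigma_finite prob_space_distr) simp
  show "sets (distr M borel (Z x n) \<Otimes>\<^sub>M gaussian (sqrt \<tau>)) = sets (distr M (borel \<Otimes>\<^sub>M borel) (\<lambda>\<omega>. (Z x n \<omega>, em_increment n \<omega>)))"
    by (simp add: sets_pair_measure_cong[OF sets_distr sets_gaussian])
  fix A :: "(real^'d) set" and B :: "(real^'m) set"
  assume "A \<in> sets (distr M borel (Z x n))" "B \<in> sets (gaussian (sqrt \<tau>))"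
  then have A [measurable]: "A \<in> sets borel" and B [measurable]: "B \<in> sets borel" by auto
  have "Z x n -` A \<inter> space M \<in> sets (F (real n * \<tau>))"
    using measurable_sets[OF em_scheme_adapted[of x n] A] by (simp add: sub)
  then have "prob ((Z x n -` A \<inter> space M) \<inter> (em_increment n -` B \<inter> space M))
    = prob (Z x n -` A \<inter> space M) * prob (em_increment n -` B \<inter> space M)"
    using B by (intro indep_setD[OF indep_increments[OF le]]) (auto simp: em_increment_def[abs_def])
  moreover have "(\<lambda>\<omega>. (Z x n \<omega>, em_increment n \<omega>)) -` (A \<times> B) \<inter> space M
    = (Z x n -` A \<inter> space M) \<inter> (em_increment n -` B \<inter> space M)" by auto
  ultimately show "emeasure (distr M borel (Z x n)) A * emeasure (gaussian (sqrt \<tau>)) B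
    = emeasure (distr M (borel \<Otimes>\<^sub>M borel) (\<lambda>\<omega>. (Z x n \<omega>, em_increment n \<omega>))) (A \<times> B)"
    unfolding law by (simp add: emeasure_distr emeasure_eq_measure ennreal_mult)
qed

lemma distr_em_scheme_1: "distr M borel (Z x 1) = distr (gaussian (sqrt \<tau>)) borel (em_step x)"
proof -
  have "Z x 1 = em_step x \<circ> em_increment 0"
    by (simp add: fun_eq_iff em_scheme_Suc)
  then have "distr M borel (Z x 1) = distr (distr M borel (em_increment 0)) borel (em_step x)"
    by (subst distr_distr) auto
  then show ?thesis by (simp add: distr_em_increment)
qed

lemma em_step_second_moment:
  "has_bochner_integral (gaussian (sqrt \<tau>)) (\<lambda>z. (norm (em_step x z))\<^sup>2)
    ((norm (x + \<tau> *\<^sub>R b x))\<^sup>2 + \<tau> * (norm (\<sigma> x))\<^sup>2)"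
  unfolding em_step_def using gaussian_second_moment[of "sqrt \<tau>" "x + \<tau> *\<^sub>R b x" "\<sigma> x"] \<tau> by simp

lemma em_scheme_square_integrable: "integrable M (\<lambda>\<omega>. (norm (Z x n \<omega>))\<^sup>2)"
proof (induction n)
  case 0
  then show ?case by simp
next
  case (Suc n)
  let ?\<mu> = "distr M borel (Z x n)" and ?G = "gaussian (sqrt \<tau>) :: (real^'m) measure"
  have "0 < sqrt \<tau>" using \<tau> by simp
  interpret G: prob_space ?G by (rule prob_space_gaussian) fact
  have "(\<integral>\<^sup>+\<omega>. ennreal ((norm (Z x (Suc n) \<omega>))\<^sup>2) \<partial>M)
    = (\<integral>\<^sup>+p. ennreal ((norm (em_step (fst p) (snd p)))\<^sup>2) \<partial>(?\<mu> \<Otimes>\<^sub>M ?G))"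
    unfolding distr_state_increment by (subst nn_integral_distr) (auto simp: em_scheme_Suc)
  also have "\<dots> = (\<integral>\<^sup>+y. \<integral>\<^sup>+z. ennreal ((norm (em_step y z))\<^sup>2) \<partial>?G \<partial>?\<mu>)"
    by (subst G.nn_integral_fst[symmetric])
       (auto cong: measurable_cong_sets simp: measurable_cong_sets[OF sets_pair_measure_cong[OF sets_distr sets_gaussian] refl])
  also have "\<dots> \<le> (\<integral>\<^sup>+y. ennreal (\<gamma> * (norm y)\<^sup>2 + C) \<partial>?\<mu>)"
  proof (rule nn_integral_mono)
    fix y
    have "(\<integral>\<^sup>+z. ennreal ((norm (em_step y z))\<^sup>2) \<partial>?G) = ennreal ((norm (y + \<tau> *\<^sub>R b y))\<^sup>2 + \<tau> * (norm (\<sigma> y))\<^sup>2)"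
      using em_step_second_moment[of y] by (subst nn_integral_eq_integral) (auto simp: has_bochner_integral_iff)
    then show "(\<integral>\<^sup>+z. ennreal ((norm (em_step y z))\<^sup>2) \<partial>?G) \<le> ennreal (\<gamma> * (norm y)\<^sup>2 + C)"
      using drift[of y] by (simp add: ennreal_leI)
  qed
  also have "\<dots> = (\<integral>\<^sup>+\<omega>. ennreal (\<gamma> * (norm (Z x n \<omega>))\<^sup>2 + C) \<partial>M)"
    by (subst nn_integral_distr) auto
  also have "\<dots> < \<infinity>"
    using Suc \<gamma> C by (subst nn_integral_eq_integral) auto
  finally show ?case
    by (intro integrableI_nonneg) auto
qed

text \<open>
  Expectations one step later are expectations of the transition operator applied to the test
  function; by induction the iterates of that operator give all expectations along the scheme.
\<close>

lemma em_transition: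
  assumes [measurable]: "\<phi> \<in> borel_measurable borel" and bd: "\<And>x. \<bar>\<phi> x\<bar> \<le> c * (1 + (norm x)\<^sup>2)"
  shows "integrable M (\<lambda>\<omega>. \<phi> (Z x n \<omega>))"
    and "(\<integral>\<omega>. \<phi> (Z x (Suc n) \<omega>) \<partial>M) = (\<integral>\<omega>. (\<integral>y. \<phi> y \<partial>distr M borel (Z (Z x n \<omega>) 1)) \<partial>M)"
proof -
  have int: "integrable M (\<lambda>\<omega>. \<phi> (Z x k \<omega>))" for k
  proof (rule Bochner_Integration.integrable_bound)
    show "integrable M (\<lambda>\<omega>. c * (1 + (norm (Z x k \<omega>))\<^sup>2))"
      using em_scheme_square_integrable[of x k] by auto
    show "AE \<omega> in M. norm (\<phi> (Z x k \<omega>)) \<le> norm (c * (1 + (norm (Z x k \<omega>))\<^sup>2))"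
      using bd by (intro AE_I2) (metis abs_ge_self order_trans real_norm_def)
  qed measurable
  then show "integrable M (\<lambda>\<omega>. \<phi> (Z x n \<omega>))" .
  let ?\<mu> = "distr M borel (Z x n)" and ?G = "gaussian (sqrt \<tau>) :: (real^'m) measure"
  have "0 < sqrt \<tau>" using \<tau> by simp
  interpret G: prob_space ?G by (rule prob_space_gaussian) fact
  interpret \<mu>: prob_space ?\<mu> by (rule prob_space_distr) simp
  interpret pair_sigma_finite ?\<mu> ?G ..
  have m: "(\<lambda>p. \<phi> (em_step (fst p) (snd p))) \<in> borel_measurable (borel \<Otimes>\<^sub>M borel)" by measurable
  have ip: "integrable (?\<mu> \<Otimes>\<^sub>M ?G) (\<lambda>p. \<phi> (em_step (fst p) (snd p)))"
    unfolding distr_state_increment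
    using int[of "Suc n"] by (subst integrable_distr_eq[OF _ m]) (auto simp: em_scheme_Suc)
  have "(\<integral>\<omega>. \<phi> (Z x (Suc n) \<omega>) \<partial>M) = (\<integral>p. \<phi> (em_step (fst p) (snd p)) \<partial>(?\<mu> \<Otimes>\<^sub>M ?G))"
    unfolding distr_state_increment by (subst integral_distr[OF _ m]) (auto simp: em_scheme_Suc)
  also have "\<dots> = (\<integral>y. \<integral>z. \<phi> (em_step y z) \<partial>?G \<partial>?\<mu>)"
    using integral_fst'[OF ip] by simp
  also have "\<dots> = (\<integral>\<omega>. \<integral>z. \<phi> (em_step (Z x n \<omega>) z) \<partial>?G \<partial>M)"
    by (intro integral_distr G.borel_measurable_lebesgue_integral)
       (auto simp: measurable_cong_sets[OF sets_pair_measure_cong[OF refl sets_gaussian] refl] case_prod_beta')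
  also have "\<dots> = (\<integral>\<omega>. (\<integral>y. \<phi> y \<partial>distr M borel (Z (Z x n \<omega>) 1)) \<partial>M)"
    unfolding distr_em_scheme_1
    by (intro Bochner_Integration.integral_cong refl integral_distr[symmetric])
       (auto simp: measurable_cong_sets[OF sets_gaussian refl])
  finally show "(\<integral>\<omega>. \<phi> (Z x (Suc n) \<omega>) \<partial>M) = (\<integral>\<omega>. (\<integral>y. \<phi> y \<partial>distr M borel (Z (Z x n \<omega>) 1)) \<partial>M)" .
qed

lemma em_geometrically_ergodic:
  "geometrically_ergodic M Z"
proof -
  define K where "K x = distr M borel (Z x 1)" for x
  define R where "R = 2 * C / (1 - \<gamma>) + 1"
  have R: "0 < R" using C \<gamma> by (auto simp: R_def add_nonneg_pos)
  have s: "0 < sqrt \<tau>" using \<tau> by simp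
  have "continuous_on UNIV (\<lambda>x. x + \<tau> *\<^sub>R b x)" by (intro continuous_intros cont_b)
  from gaussian_kernel_minorization[OF this cont_\<sigma> nondegenerate_if_positive_definite[OF positive_definite] s, of "sqrt R"]
  obtain \<nu> :: "(real^'d) measure" where \<nu>: "sets \<nu> = sets borel" "finite_measure \<nu>" "0 < measure \<nu> (space \<nu>)"
    "\<And>x B. norm x \<le> sqrt R \<Longrightarrow> B \<in> sets borel \<Longrightarrow>
      emeasure \<nu> B \<le> emeasure (distr (gaussian (sqrt \<tau>)) borel (\<lambda>z. (x + \<tau> *\<^sub>R b x) + \<sigma> x *v z)) B"
    using R by auto
  have K_step: "K x = distr (gaussian (sqrt \<tau>)) borel (em_step x)" for x
    unfolding K_def by (rule distr_em_scheme_1)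
  have moment: "has_bochner_integral (K x) (\<lambda>y. (norm y)\<^sup>2) ((norm (x + \<tau> *\<^sub>R b x))\<^sup>2 + \<tau> * (norm (\<sigma> x))\<^sup>2)" for x
    unfolding K_step using em_step_second_moment[of x]
    by (intro has_bochner_integral_distr) (auto simp: measurable_cong_sets[OF sets_gaussian refl])
  interpret H: harris_chain borel K "\<lambda>x. (norm x)\<^sup>2" \<gamma> C R \<nu>
  proof (rule harris_chain.intro)
    have "(\<lambda>(x, \<omega>). em_step x (em_increment 0 \<omega>)) \<in> borel \<Otimes>\<^sub>M M \<rightarrow>\<^sub>M borel"
      by measurable
    then show "K \<in> borel \<rightarrow>\<^sub>M prob_algebra borel"
      unfolding K_def
      by (intro measurable_distr_prob_space2[where M = M])
         (auto simp: em_scheme_Suc space_prob_algebra prob_space_axioms intro!: measurable_const)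
    show "integrable (K x) (\<lambda>x. (norm x)\<^sup>2)" for x using moment[of x] by (simp add: has_bochner_integral_iff)
    show "(\<integral>y. (norm y)\<^sup>2 \<partial>K x) \<le> \<gamma> * (norm x)\<^sup>2 + C" for x
      using moment[of x] drift[of x] by (simp add: has_bochner_integral_iff)
    show "emeasure \<nu> A \<le> emeasure (K x) A" if "(norm x)\<^sup>2 \<le> R" "A \<in> sets borel" for x A
    proof -
      have "norm x \<le> sqrt R" using that(1) by (simp add: real_le_rsqrt)
      from \<nu>(4)[OF this that(2)] show ?thesis by (simp add: K_step em_step_def[abs_def])
    qed
    show "2 * C / (1 - \<gamma>) < R" by (simp add: R_def)
  qed (use \<gamma> C \<nu>(1-3) in simp_all)
  have iter: "(\<integral>\<omega>. \<phi> (Z x n \<omega>) \<partial>M) = (H.transition ^^ n) \<phi> x" if "H.dominated c \<phi>" for \<phi> x n c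
    using that
  proof (induction n arbitrary: \<phi> c)
    case 0
    then show ?case by (simp add: prob_space)
  next
    case (Suc n)
    have "(\<integral>\<omega>. \<phi> (Z x (Suc n) \<omega>) \<partial>M) = (\<integral>\<omega>. H.transition \<phi> (Z x n \<omega>) \<partial>M)"
      using em_transition(2)[of \<phi> c] Suc.prems by (simp add: H.dominated_def H.transition_def K_def)
    also have "\<dots> = (H.transition ^^ n) (H.transition \<phi>) x"
      by (rule Suc.IH[OF H.transition_dominated[OF Suc.prems]])
    finally show ?case by (simp only: funpow_Suc_right o_def)
  qed
  have inv: "H.invariant \<mu> \<longleftrightarrow> invariant_prob M Z \<mu>" for \<mu>
    by (simp add: H.invariant_def invariant_prob_def K_def)
  show ?thesis
    unfolding geometrically_ergodic_def
  proof (intro exI conjI bexI allI impI)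
    show "invariant_prob M Z H.stationary" using H.invariant_stationary by (simp add: inv)
    show "\<pi>' = H.stationary" if "invariant_prob M Z \<pi>'" for \<pi>'
      using that by (intro H.invariant_unique) (simp add: inv)
    show "0 < H.bound_const" by (rule H.bound_const_pos)
    show "H.contraction_rate \<in> {0<..<1}" using H.contraction_rate by simp
    fix \<phi> :: "real^'d \<Rightarrow> real" assume \<phi>: "\<phi> \<in> borel_measurable borel" "\<forall>x. \<bar>\<phi> x\<bar> \<le> 1 + (norm x)\<^sup>2"
    from \<phi>(2) have bd: "\<bar>\<phi> x\<bar> \<le> 1 + (norm x)\<^sup>2" for x by blast
    from \<phi> have d: "H.dominated 1 \<phi>" by (simp add: H.dominated_def)
    show "integrable H.stationary \<phi>" by (rule H.geometric_convergence(1)[OF \<phi>(1) bd])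
    fix x n
    show "integrable M (\<lambda>\<omega>. \<phi> (Z x n \<omega>))" using em_transition(1)[OF \<phi>(1), of 1] bd by simp
    show "\<bar>(\<integral>\<omega>. \<phi> (Z x n \<omega>) \<partial>M) - (\<integral>y. \<phi> y \<partial>H.stationary)\<bar>
      \<le> H.bound_const * H.contraction_rate ^ n * (1 + (norm x)\<^sup>2)"
      unfolding iter[OF d] by (rule H.geometric_convergence(2)[OF \<phi>(1) bd]) simp
  qed
qed

end

section \<open>Dissipativity of the tamed schemes\<close>

lemma continuously_differentiable_imp_continuous:
  "continuously_differentiable f \<Longrightarrow> continuous_on UNIV f"
  unfolding continuously_differentiable_def
  by (meson continuous_at_imp_continuous_on has_derivative_continuous)

text \<open>
  Expanding \<open>|x + \<tau> b(x)|\<^sup>2\<close> turns dissipativity into a drift with rate \<open>1 - \<tau> T\<^sub>2\<close>. The maximum with \<open>0\<close> only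
  serves to have a nonnegative rate for every \<open>\<tau>\<close>.
\<close>

lemma geometrically_ergodic_if_dissipative:
  fixes W :: "real \<Rightarrow> 'w \<Rightarrow> real ^ 'm" and b :: "real ^ 'd \<Rightarrow> real ^ 'd" and \<sigma> :: "real ^ 'd \<Rightarrow> real ^ 'm ^ 'd"
  assumes W: "wiener_process M F W" and \<tau>: "0 < \<tau>" and T: "0 < T1" "0 < T2"
    and smooth: "continuously_differentiable b" "continuously_differentiable \<sigma>"
    and pd: "\<And>x. positive_definite (\<sigma> x ** transpose (\<sigma> x))"
    and dissipative: "\<And>x. 2 * (x \<bullet> b x) + (norm (\<sigma> x))\<^sup>2 + \<tau> * (norm (b x))\<^sup>2 \<le> T1 - T2 * (norm x)\<^sup>2"
  shows "geometrically_ergodic M (em_scheme b \<sigma> W \<tau>)"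
proof -
  interpret wiener_process M F W by (rule W)
  interpret euler_maruyama M F W b \<sigma> \<tau> "max 0 (1 - \<tau> * T2)" "\<tau> * T1"
  proof
    fix x :: "real^'d"
    have "(norm (x + \<tau> *\<^sub>R b x))\<^sup>2 + \<tau> * (norm (\<sigma> x))\<^sup>2
      = (norm x)\<^sup>2 + \<tau> * (2 * (x \<bullet> b x) + (norm (\<sigma> x))\<^sup>2 + \<tau> * (norm (b x))\<^sup>2)"
      unfolding power2_norm_eq_inner
      by (simp add: inner_add_left inner_add_right inner_commute algebra_simps)
    also have "\<dots> \<le> (norm x)\<^sup>2 + \<tau> * (T1 - T2 * (norm x)\<^sup>2)"
      using dissipative[of x] \<tau> by simp
    also have "\<dots> = (1 - \<tau> * T2) * (norm x)\<^sup>2 + \<tau> * T1"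
      by (simp add: algebra_simps)
    also have "\<dots> \<le> max 0 (1 - \<tau> * T2) * (norm x)\<^sup>2 + \<tau> * T1"
      by (intro add_right_mono mult_right_mono) auto
    finally show "(norm (x + \<tau> *\<^sub>R b x))\<^sup>2 + \<tau> * (norm (\<sigma> x))\<^sup>2 \<le> max 0 (1 - \<tau> * T2) * (norm x)\<^sup>2 + \<tau> * T1" .
  qed (use \<tau> T pd smooth[THEN continuously_differentiable_imp_continuous] in auto)
  show ?thesis by (rule em_geometrically_ergodic)
qed

text \<open>
  Write \<open>u = |x|\<^sup>q\<close> and \<open>D = (1 + \<tau> u\<^sup>2)\<^sup>1\<^sup>/\<^sup>2\<close>. Since \<open>\<tau> u\<^sup>2 \<le> D\<^sup>2\<close>, taming reduces \<open>\<tau> |b|\<^sup>2\<close> to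
  quadratic growth. Once \<open>\<surd>\<tau> u \<ge> 1\<close>, also \<open>D \<le> 2 \<surd>\<tau> u\<close>, so the inward drift \<open>|x|\<^sup>q\<^sup>+\<^sup>2 / D\<close> is still at least
  \<open>|x|\<^sup>2 / (2 \<surd>\<tau>)\<close>; the remaining \<open>x\<close> lie in a ball of radius \<open>(1 / \<surd>\<tau>)\<^sup>1\<^sup>/\<^sup>q\<close>, which explains the constant.
  The smallness of \<open>\<tau>\<close> makes the inward drift exceed both quadratic terms by \<open>|x|\<^sup>2\<close>.
\<close>

lemma tamed_drift_dissipative:
  fixes x bx :: "'a::real_inner"
  assumes pos: "0 < L3" "0 < L4" "0 < L1" "0 < L2" "0 < L4'" "0 < q"
    and \<tau>: "0 < \<tau>" "\<tau> \<le> 1" and small: "sqrt \<tau> * (2 * (L4' + 2 * L4\<^sup>2 + 1)) \<le> L2"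
    and growth: "norm bx \<le> L3 + L4 * norm x powr (q + 1)"
    and diss: "2 * (x \<bullet> bx) \<le> L1 - L2 * norm x powr (q + 2)"
    and diffusion: "s \<le> L3' + L4' * (norm x)\<^sup>2"
    and t: "t = bx /\<^sub>R sqrt (1 + \<tau> * norm x powr (2 * q))"
  shows "2 * (x \<bullet> t) + s + \<tau> * (norm t)\<^sup>2
    \<le> (L1 + L2 / (2 * sqrt \<tau>) * ((1 / sqrt \<tau>) powr (1 / q))\<^sup>2 + L3' + 2 * L3\<^sup>2) - 1 * (norm x)\<^sup>2"
proof -
  define n where "n = norm x"
  define u where "u = n powr q"
  define D where "D = sqrt (1 + \<tau> * u\<^sup>2)"
  define \<rho> where "\<rho> = (1 / sqrt \<tau>) powr (1 / q)"
  have n: "0 \<le> n" by (simp add: n_def)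
  have u: "0 \<le> u" by (simp add: u_def)
  have pw: "n powr (2 * q) = u\<^sup>2" "n powr (q + 1) = u * n" "n powr (q + 2) = u * n\<^sup>2"
    using powr_add[of n q q] powr_add[of n q 1] powr_add[of n q 2] n
    by (simp_all add: u_def power2_eq_square)
  have D2: "D\<^sup>2 = 1 + \<tau> * u\<^sup>2" using \<tau> by (simp add: D_def)
  have D1: "1 \<le> D" using \<tau> by (simp add: D_def)
  have t': "t = bx /\<^sub>R D" by (simp only: t D_def n_def[symmetric] pw(1))
  have noise: "\<tau> * (norm t)\<^sup>2 \<le> 2 * L3\<^sup>2 + 2 * L4\<^sup>2 * n\<^sup>2"
  proof -
    have "(norm bx)\<^sup>2 \<le> (L3 + L4 * (u * n))\<^sup>2"
      using growth by (intro power_mono) (auto simp: n_def[symmetric] pw)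
    also have "\<dots> \<le> 2 * L3\<^sup>2 + 2 * (L4 * (u * n))\<^sup>2"
      using sum_squares_bound[of L3 "L4 * (u * n)"] by (simp add: power2_sum)
    finally have "\<tau> * (norm bx)\<^sup>2 \<le> \<tau> * (2 * L3\<^sup>2 + 2 * (L4 * (u * n))\<^sup>2)"
      using \<tau> by simp
    also have "\<dots> = \<tau> * (2 * L3\<^sup>2) + (2 * L4\<^sup>2 * n\<^sup>2) * (\<tau> * u\<^sup>2)"
      by (simp add: power_mult_distrib algebra_simps)
    also have "\<dots> \<le> 1 * (2 * L3\<^sup>2) * D\<^sup>2 + (2 * L4\<^sup>2 * n\<^sup>2) * D\<^sup>2"
    proof (rule add_mono)
      have "\<tau> * (2 * L3\<^sup>2) \<le> 1 * (2 * L3\<^sup>2)" using \<tau> by (intro mult_right_mono) auto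
      also have "\<dots> \<le> 1 * (2 * L3\<^sup>2) * D\<^sup>2" using \<tau> unfolding D2 by (simp add: mult_le_cancel_left1)
      finally show "\<tau> * (2 * L3\<^sup>2) \<le> 1 * (2 * L3\<^sup>2) * D\<^sup>2" .
      show "(2 * L4\<^sup>2 * n\<^sup>2) * (\<tau> * u\<^sup>2) \<le> (2 * L4\<^sup>2 * n\<^sup>2) * D\<^sup>2" unfolding D2 by (intro mult_left_mono) auto
    qed
    finally have "\<tau> * (norm bx)\<^sup>2 \<le> (2 * L3\<^sup>2 + 2 * L4\<^sup>2 * n\<^sup>2) * D\<^sup>2" by (simp add: algebra_simps)
    then have "\<tau> * (norm bx)\<^sup>2 / D\<^sup>2 \<le> 2 * L3\<^sup>2 + 2 * L4\<^sup>2 * n\<^sup>2"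
      using D1 by (simp add: divide_le_eq)
    moreover have "\<tau> * (norm t)\<^sup>2 = \<tau> * (norm bx)\<^sup>2 / D\<^sup>2"
      by (simp add: t' power_mult_distrib field_simps)
    ultimately show ?thesis by simp
  qed
  have taming: "n\<^sup>2 / (2 * sqrt \<tau>) - \<rho>\<^sup>2 / (2 * sqrt \<tau>) \<le> u * n\<^sup>2 / D"
  proof (cases "1 \<le> sqrt \<tau> * u")
    case True
    have "1 \<le> (sqrt \<tau> * u)\<^sup>2" using True by simp
    then have "D\<^sup>2 \<le> (2 * sqrt \<tau> * u)\<^sup>2" using \<tau> by (simp add: D2 power_mult_distrib)
    then have "D \<le> 2 * sqrt \<tau> * u" using \<tau> u by (intro power2_le_imp_le[of D]) auto
    then have "n\<^sup>2 * D \<le> n\<^sup>2 * (2 * sqrt \<tau> * u)" by (intro mult_left_mono) auto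
    then have "n\<^sup>2 / (2 * sqrt \<tau>) \<le> u * n\<^sup>2 / D" using D1 \<tau> by (simp add: field_simps)
    moreover have "0 \<le> \<rho>\<^sup>2 / (2 * sqrt \<tau>)" using \<tau> by simp
    ultimately show ?thesis by linarith
  next
    case False
    then have "u \<le> 1 / sqrt \<tau>" using \<tau> by (simp add: field_simps)
    then have "u powr (1 / q) \<le> \<rho>" unfolding \<rho>_def using u pos by (intro powr_mono2) auto
    then have "n \<le> \<rho>" using n pos by (simp add: u_def powr_powr)
    then have "n\<^sup>2 / (2 * sqrt \<tau>) \<le> \<rho>\<^sup>2 / (2 * sqrt \<tau>)" using n \<tau> by (intro divide_right_mono power_mono) auto
    moreover have "0 \<le> u * n\<^sup>2 / D" using u D1 by simp
    ultimately show ?thesis by linarith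
  qed
  have "2 * (x \<bullet> t) = (2 * (x \<bullet> bx)) / D" by (simp add: t' divide_inverse)
  also have "\<dots> \<le> (L1 - L2 * (u * n\<^sup>2)) / D"
    using diss D1 by (intro divide_right_mono) (auto simp: n_def[symmetric] pw)
  also have "\<dots> = L1 / D - L2 * (u * n\<^sup>2 / D)" by (simp add: diff_divide_distrib)
  also have "\<dots> \<le> L1 - L2 * (n\<^sup>2 / (2 * sqrt \<tau>) - \<rho>\<^sup>2 / (2 * sqrt \<tau>))"
  proof (rule diff_mono)
    show "L1 / D \<le> L1" using D1 pos by (simp add: divide_le_eq mult_le_cancel_left1)
    show "L2 * (n\<^sup>2 / (2 * sqrt \<tau>) - \<rho>\<^sup>2 / (2 * sqrt \<tau>)) \<le> L2 * (u * n\<^sup>2 / D)"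
      using taming pos by (intro mult_left_mono) auto
  qed
  finally have drift: "2 * (x \<bullet> t) \<le> L1 + L2 / (2 * sqrt \<tau>) * \<rho>\<^sup>2 - L2 / (2 * sqrt \<tau>) * n\<^sup>2"
    by (simp add: algebra_simps)
  have "L4' + 2 * L4\<^sup>2 + 1 \<le> L2 / (2 * sqrt \<tau>)" using small \<tau> by (simp add: field_simps)
  then have "(L4' + 2 * L4\<^sup>2 + 1) * n\<^sup>2 \<le> L2 / (2 * sqrt \<tau>) * n\<^sup>2" by (rule mult_right_mono) simp
  then show ?thesis
    using drift noise diffusion unfolding \<rho>_def[symmetric] n_def[symmetric] by (simp add: algebra_simps)
qed

theorem theorem2:
  fixes M :: "'w measure" and F :: "real \<Rightarrow> 'w measure" and W :: "real \<Rightarrow> 'w \<Rightarrow> real ^ 'm"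
    and b :: "real ^ 'd \<Rightarrow> real ^ 'd" and \<sigma> :: "real ^ 'd \<Rightarrow> real ^ 'm ^ 'd"
  assumes "wiener_process M F W"
  shows
    "(\<forall>(L0::real) L1 L2 L3 L4 (q::real) (b\<tau> :: real \<Rightarrow> real ^ 'd \<Rightarrow> real ^ 'd)
        (\<sigma>\<tau> :: real \<Rightarrow> real ^ 'd \<Rightarrow> real ^ 'm ^ 'd).
        0 < L0 \<and> 0 < L1 \<and> 0 < L2 \<and> 0 < L3 \<and> 0 < L4 \<and> 0 < q \<longrightarrow>
        (\<forall>x y. 2 * ((x - y) \<bullet> (b x - b y)) + (norm (\<sigma> x - \<sigma> y))\<^sup>2 \<le> L0 * (norm (x - y))\<^sup>2) \<longrightarrow>
        (\<forall>x. 2 * (x \<bullet> b x) + (norm (\<sigma> x))\<^sup>2 \<le> L1 - L2 * norm x powr (q + 2)) \<longrightarrow>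
        (\<forall>x. norm (b x) \<le> L3 + L4 * norm x powr (q + 1)) \<longrightarrow>
        tamed_coefficients b \<sigma> b\<tau> \<sigma>\<tau> \<longrightarrow>
        (\<forall>\<tau>\<in>{0<..1}. continuously_differentiable (b\<tau> \<tau>) \<and> continuously_differentiable (\<sigma>\<tau> \<tau>)) \<longrightarrow>
        (\<forall>\<tau>\<in>{0<..1}. \<forall>x. positive_definite (\<sigma>\<tau> \<tau> x ** transpose (\<sigma>\<tau> \<tau> x))) \<longrightarrow>
        (\<exists>\<tau>max\<in>{0<..1}. \<forall>\<tau>\<in>{0<..\<tau>max}.
          geometrically_ergodic M (em_scheme (b\<tau> \<tau>) (\<sigma>\<tau> \<tau>) W \<tau>))) \<and>
     (\<forall>(L3::real) L4 L1' L2' L3' L4' (q::real) (b\<tau> :: real \<Rightarrow> real ^ 'd \<Rightarrow> real ^ 'd).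
        0 < L3 \<and> 0 < L4 \<and> 0 < L1' \<and> 0 < L2' \<and> 0 < L3' \<and> 0 < L4' \<and> 0 < q \<longrightarrow>
        (\<forall>x. norm (b x) \<le> L3 + L4 * norm x powr (q + 1)) \<longrightarrow>
        (\<forall>x. 2 * (x \<bullet> b x) \<le> L1' - L2' * norm x powr (q + 2)) \<longrightarrow>
        (\<forall>x. (norm (\<sigma> x))\<^sup>2 \<le> L3' + L4' * (norm x)\<^sup>2) \<longrightarrow>
        (\<forall>\<tau>\<in>{0<..1}. \<forall>x. b\<tau> \<tau> x = b x /\<^sub>R sqrt (1 + \<tau> * norm x powr (2 * q))) \<longrightarrow>
        (\<forall>\<tau>\<in>{0<..1}. continuously_differentiable (b\<tau> \<tau>)) \<longrightarrow>
        continuously_differentiable \<sigma> \<longrightarrow>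
        (\<forall>x. positive_definite (\<sigma> x ** transpose (\<sigma> x))) \<longrightarrow>
        (\<exists>\<tau>max\<in>{0<..1}. \<forall>\<tau>\<in>{0<..\<tau>max}.
          geometrically_ergodic M (em_scheme (b\<tau> \<tau>) \<sigma> W \<tau>)))"
proof (intro conjI allI impI)
  fix L0 L1 L2 L3 L4 q :: real and b\<tau> :: "real \<Rightarrow> real ^ 'd \<Rightarrow> real ^ 'd"
    and \<sigma>\<tau> :: "real \<Rightarrow> real ^ 'd \<Rightarrow> real ^ 'm ^ 'd"
  assume "tamed_coefficients b \<sigma> b\<tau> \<sigma>\<tau>"
    and smooth: "\<forall>\<tau>\<in>{0<..1}. continuously_differentiable (b\<tau> \<tau>) \<and> continuously_differentiable (\<sigma>\<tau> \<tau>)"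
    and pd: "\<forall>\<tau>\<in>{0<..1}. \<forall>x. positive_definite (\<sigma>\<tau> \<tau> x ** transpose (\<sigma>\<tau> \<tau> x))"
  then obtain T1 T2 where T: "0 < T1" "0 < T2" and
    diss: "\<forall>\<tau>\<in>{0<..1}. \<forall>x. 2 * (x \<bullet> b\<tau> \<tau> x) + (norm (\<sigma>\<tau> \<tau> x))\<^sup>2 + \<tau> * (norm (b\<tau> \<tau> x))\<^sup>2 \<le> T1 - T2 * (norm x)\<^sup>2"
    unfolding tamed_coefficients_def by blast
  show "\<exists>\<tau>max\<in>{0<..1}. \<forall>\<tau>\<in>{0<..\<tau>max}. geometrically_ergodic M (em_scheme (b\<tau> \<tau>) (\<sigma>\<tau> \<tau>) W \<tau>)"
  proof (intro bexI ballI)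
    fix \<tau> :: real assume \<tau>: "\<tau> \<in> {0<..1}"
    show "geometrically_ergodic M (em_scheme (b\<tau> \<tau>) (\<sigma>\<tau> \<tau>) W \<tau>)"
      by (rule geometrically_ergodic_if_dissipative[OF assms _ T]) (use \<tau> smooth pd diss in auto)
  qed simp
next
  fix L3 L4 L1' L2' L3' L4' q :: real and b\<tau> :: "real \<Rightarrow> real ^ 'd \<Rightarrow> real ^ 'd"
  assume pos: "0 < L3 \<and> 0 < L4 \<and> 0 < L1' \<and> 0 < L2' \<and> 0 < L3' \<and> 0 < L4' \<and> 0 < q"
    and growth: "\<forall>x. norm (b x) \<le> L3 + L4 * norm x powr (q + 1)"
    and diss: "\<forall>x. 2 * (x \<bullet> b x) \<le> L1' - L2' * norm x powr (q + 2)"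
    and diffusion: "\<forall>x. (norm (\<sigma> x))\<^sup>2 \<le> L3' + L4' * (norm x)\<^sup>2"
    and tame: "\<forall>\<tau>\<in>{0<..1}. \<forall>x. b\<tau> \<tau> x = b x /\<^sub>R sqrt (1 + \<tau> * norm x powr (2 * q))"
    and smooth: "\<forall>\<tau>\<in>{0<..1}. continuously_differentiable (b\<tau> \<tau>)" "continuously_differentiable \<sigma>"
    and pd: "\<forall>x. positive_definite (\<sigma> x ** transpose (\<sigma> x))"
  \<comment> \<open>the bound on \<open>\<surd>\<tau>\<close> under which the tamed drift dominates the noise and the discretization error\<close>
  define h where "h = L2' / (2 * (L4' + 2 * L4\<^sup>2 + 1))"
  have den: "0 < 2 * (L4' + 2 * L4\<^sup>2 + 1)" using pos by (simp add: add_pos_nonneg)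
  then have h: "0 < h" using pos by (simp add: h_def)
  show "\<exists>\<tau>max\<in>{0<..1}. \<forall>\<tau>\<in>{0<..\<tau>max}. geometrically_ergodic M (em_scheme (b\<tau> \<tau>) \<sigma> W \<tau>)"
  proof (intro bexI ballI)
    show "min 1 (h\<^sup>2) \<in> {0<..1}" using h by auto
    fix \<tau> assume "\<tau> \<in> {0<..min 1 (h\<^sup>2)}"
    then have \<tau>: "0 < \<tau>" "\<tau> \<le> 1" "\<tau> \<le> h\<^sup>2" by auto
    then have "sqrt \<tau> \<le> h" using h by (intro real_le_lsqrt) auto
    then have small: "sqrt \<tau> * (2 * (L4' + 2 * L4\<^sup>2 + 1)) \<le> L2'"
      using den by (simp add: h_def pos_le_divide_eq)
    let ?T = "L1' + L2' / (2 * sqrt \<tau>) * ((1 / sqrt \<tau>) powr (1 / q))\<^sup>2 + L3' + 2 * L3\<^sup>2"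
    have "0 < ?T" using pos \<tau> by (simp add: add_pos_nonneg)
    then show "geometrically_ergodic M (em_scheme (b\<tau> \<tau>) \<sigma> W \<tau>)"
    proof (rule geometrically_ergodic_if_dissipative[OF assms \<tau>(1) _ zero_less_one])
      fix x
      show "2 * (x \<bullet> b\<tau> \<tau> x) + (norm (\<sigma> x))\<^sup>2 + \<tau> * (norm (b\<tau> \<tau> x))\<^sup>2 \<le> ?T - 1 * (norm x)\<^sup>2"
        by (rule tamed_drift_dissipative[OF _ _ _ _ _ _ \<tau>(1,2) small, of _ _ _ "b x"])
           (use pos growth diss diffusion tame \<tau> in auto)
    qed (use smooth pd \<tau> in auto)
  qed
qed

end
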